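(* Let $m\ge2$ be an integer and let $\Psi_i=(\gamma_{i1},\gamma_{i2},\dots)$, $0\le i\le m-1$, be infinite positive vectors with $\sum_{j\ge1}\gamma_{ij}<\infty$ for each $i$ and $\sup_{i,j}\gamma_{ij}<1$. Then for any compact set of frequencies $K\subset\mathcal V\subset\mathbb R^m$ there exist a constant $C(K)>0$ and an integer $q(K)$ such that, if $x\in\mathcal Q_m$, $y\in F(\rho_0,\dots,\rho_{m-1})\subset\mathcal Q_m$ and $(\rho_0,\dots,\rho_{m-1})\in K$, then $$|H_m(y)-H_m(x)|\ge C(K)\cdot\mathrm{dist}\big((\rho_0,\dots,\rho_{m-1}),Z_x\big)^{q(K)},$$ where $Z_x=\{\eta\in\mathcal V:\Delta(\eta)=H_m(x)\}$ is a real-analytic subvariety in $\mathbb R^m$. In particular, if $H_m(y)=H_m(x)$ and $y\in F(\rho_0,\dots,\rho_{m-1})$, then the frequency vector $(\rho_0,\dots,\rho_{m-1})$ must belong to the real-analytic subvariety $Z_x\subset\mathbb R^m$. The same conclusions hold for $H_\beta$, where $\beta>1$, $\beta\notin\mathbb Z$ (with positive vectors $\Psi_i$, $0\le i\le[\beta]$, satisfying the same conditions, and with $\mathcal Q_\beta$, $F(\rho_0,\dots,\rho_{[\beta]})$ and $\mathbb R^{[\beta]+1}$ in place of $\mathcal Q_m$, $F(\rho_0,\dots,\rho_{m-1})$ and $\mathbb R^m$).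
   Context: $[y]$ is the integer part; $\mathbb N=\{1,2,\dots\}$; $|B|$ is the diameter of $B\subset\mathbb R^d$; $\dim_{\mathrm H}$ is Hausdorff dimension. Expansions. Let $b=m$ (an integer $\ge2$) or $b=\beta$ (with $\beta>1$, $\beta\notin\mathbb Z$), $T_b(x)=bx\bmod1$ on $[0,1)$, $d_k(x)=[b\,T_b^{k-1}(x)]$, $k\ge1$, so $x=\sum_{k\ge1}d_k(x)b^{-k}$. The digits lie in $I=\{0,\dots,m-1\}$, resp. $I=\{0,\dots,[\beta]\}$. $\mathcal V$ is the relative interior of the simplex $\{\eta=(\eta_i)_{i\in I}\in[0,1]^I:\sum_i\eta_i=1\}$, i.e. the set of stochastic vectors with all entries positive. For $p\in\mathcal V$, $F(p)$ is the set of $x\in[0,1)$ with $\lim_{n\to\infty}\frac1n\mathrm{Card}\{1\le j\le n:d_j(x)=i\}=p_i$ for all $i\in I$. $\mathcal Q_m$ (resp. $\mathcal Q_\beta$) is the union of all $F(p)$, $p\in\mathcal V$. Moran fractals. For $x\in F(p)$ put $c_{kj}:=\gamma_{d_k(x)\,j}$, $k,j\ge1$. Let $D_0=\{\emptyset\}$ (empty word), $D_k=\mathbb N^k$, $D=\bigcup_{k\ge0}D_k$, $D_\infty=\mathbb N^{\mathbb N}$; $\sigma|_k$ is truncation to length $k$; $\sigma*j$ is $\sigma$ followed by $j$. $J\subset\mathbb R^d$ is a fixed nonempty compact set with $J=\mathrm{cl}(\mathrm{int}\,J)$, $|J|=1$. Take a collection $\{J_\sigma:\sigma\in D\}$ with: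 (1) $J_\emptyset=J$; (2) each $J_\sigma$ is the image of $J$ under a similarity of $\mathbb R^d$; (3) for $\sigma\in D$, the sets $J_{\sigma*1},J_{\sigma*2},\dots$ are subsets of $J_\sigma$ with pairwise disjoint interiors; (4) $|J_{\sigma*j}|/|J_\sigma|=c_{kj}$ for $k\ge1$, $\sigma\in D_{k-1}$, $j\ge1$ (it is understood that such collections exist). The Moran fractal $\bigcup_{\sigma\in D_\infty}\bigcap_{i\ge1}J_{\sigma|_i}$ is denoted $E(x;m)$, resp. $E(x;\beta)$; $H_m(x)=\dim_{\mathrm H}(E(x;m))$ on $\mathcal Q_m$ and $H_\beta(x)=\dim_{\mathrm H}(E(x;\beta))$ on $\mathcal Q_\beta$. Let $\theta=\max_{i\in I}\inf\{t>0:\sum_j\gamma_{ij}^t<\infty\}$ and $P_\eta(t)=\sum_{i\in I}\eta_i\log\sum_{j\ge1}\gamma_{ij}^t$ for $t>\theta$. Standing assumptions: $\sum_j\gamma_{ij}^\theta=\infty$ for some $i\in I$, and $0<P_\eta(u)<\infty$ for some $u\in(\theta,\infty)$. For $\eta\in\mathcal V$, $\Delta(\eta)$ denotes the Hausdorff dimension of the Moran fractals with contraction vectors $\Psi_i$ built from any digit sequence in $I^{\mathbb N}$ with frequency vector $\eta$; by a result of the paper it equals the unique zero of $P_\eta$ in $(\theta,\infty)$ and so depends only on $\eta$. *)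

theory Defs
  imports "HOL-Analysis.Analysis"
begin

section \<open>Hausdorff dimension\<close>

text \<open>Boundedness of the covering sets is required explicitly because \<^const>\<open>diameter\<close> carries
  no information on unbounded sets.\<close>

definition hausdorff_premeasure :: "real \<Rightarrow> real \<Rightarrow> 'a::metric_space set \<Rightarrow> ennreal" where
  "hausdorff_premeasure s \<delta> E =
     Inf {(\<Sum>k. ennreal (diameter (U k) powr s)) | U :: nat \<Rightarrow> 'a set.
            E \<subseteq> (\<Union>k. U k) \<and> (\<forall>k. bounded (U k) \<and> diameter (U k) \<le> \<delta>)}"

definition hausdorff_measure :: "real \<Rightarrow> 'a::metric_space set \<Rightarrow> ennreal" where
  "hausdorff_measure s E = (SUP \<delta>\<in>{0<..}. hausdorff_premeasure s \<delta> E)"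

text \<open>Only exponents \<open>s > 0\<close> are used, so the value of \<open>0 powr 0\<close> plays no role; this does not
  change the infimum.  In a Euclidean space of dimension \<open>d\<close> the set below contains every \<open>s > d\<close>,
  so the real-valued infimum is the usual one.\<close>

definition hausdorff_dim :: "'a::euclidean_space set \<Rightarrow> real" where
  "hausdorff_dim E = Inf {s. 0 < s \<and> hausdorff_measure s E = 0}"


section \<open>Real-analytic subvarieties\<close>

text \<open>A power series in several variables is indexed by multi-indices \<open>\<alpha>\<close>.\<close>

definition real_analytic_on :: "(real^'n \<Rightarrow> real) \<Rightarrow> (real^'n) set \<Rightarrow> bool" where
  "real_analytic_on f N \<longleftrightarrow>
     (\<forall>a\<in>N. \<exists>r>0. \<exists>c :: ('n \<Rightarrow> nat) \<Rightarrow> real. \<forall>x\<in>ball a r.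
        ((\<lambda>\<alpha>. c \<alpha> * (\<Prod>i\<in>UNIV. (x $ i - a $ i) ^ \<alpha> i)) has_sum f x) UNIV)"

text \<open>\<open>Z\<close> is a real-analytic subvariety of the open set \<open>U\<close>: near each point of \<open>U\<close> (not only of
  \<open>Z\<close>, so \<open>Z\<close> is relatively closed in \<open>U\<close>) it is the common zero set of finitely many
  real-analytic functions.\<close>

definition real_analytic_subvariety :: "(real^'n) set \<Rightarrow> (real^'n) set \<Rightarrow> bool" where
  "real_analytic_subvariety U Z \<longleftrightarrow>
     open U \<and> Z \<subseteq> U \<and>
     (\<forall>a\<in>U. \<exists>N fs. open N \<and> a \<in> N \<and> N \<subseteq> U \<and> finite fs \<and>
        (\<forall>f\<in>fs. real_analytic_on f N) \<and> Z \<inter> N = {z \<in> N. \<forall>f\<in>fs. f z = 0})"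


section \<open>Expansions and digit frequencies\<close>

text \<open>All sequences are indexed from \<open>0\<close>: \<open>digit b x k\<close> is the digit \<open>d_(k+1)(x)\<close>.\<close>

definition base_map :: "real \<Rightarrow> real \<Rightarrow> real" where
  "base_map b x = frac (b * x)"

definition digit :: "real \<Rightarrow> real \<Rightarrow> nat \<Rightarrow> int" where
  "digit b x k = \<lfloor>b * (base_map b ^^ k) x\<rfloor>"

text \<open>The digit alphabet \<open>I\<close> is a finite type \<open>'n\<close>, identified with the actual set of digits
  (\<open>{0..m-1}\<close> or \<open>{0..\<lfloor>\<beta>\<rfloor>}\<close>) by a bijection \<open>letter\<close>.  Then \<open>I^\<nat>\<close> is
  \<open>nat \<Rightarrow> 'n\<close> and \<open>\<real>^I\<close> is \<open>real^'n\<close>.\<close>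

definition digit_word :: "(int \<Rightarrow> 'n) \<Rightarrow> real \<Rightarrow> real \<Rightarrow> nat \<Rightarrow> 'n" where
  "digit_word letter b x k = letter (digit b x k)"

definition has_frequencies :: "(nat \<Rightarrow> 'n::finite) \<Rightarrow> real^'n \<Rightarrow> bool" where
  "has_frequencies \<omega> p \<longleftrightarrow>
     (\<forall>i. (\<lambda>n. real (card {k. k < n \<and> \<omega> k = i}) / real n) \<longlonglongrightarrow> p $ i)"

definition pos_stochastic :: "(real^'n::finite) set" where
  "pos_stochastic = {\<eta>. (\<forall>i. 0 < \<eta> $ i) \<and> (\<Sum>i\<in>UNIV. \<eta> $ i) = 1}"

definition freq_set :: "(int \<Rightarrow> 'n::finite) \<Rightarrow> real \<Rightarrow> real^'n \<Rightarrow> real set" where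
  "freq_set letter b p = {x \<in> {0..<1}. has_frequencies (digit_word letter b x) p}"

definition all_freq_set :: "(int \<Rightarrow> 'n::finite) \<Rightarrow> real \<Rightarrow> real set" where
  "all_freq_set letter b = (\<Union>p\<in>pos_stochastic. freq_set letter b p)"


section \<open>Moran fractals\<close>

definition similarity :: "('a::metric_space \<Rightarrow> 'a) \<Rightarrow> bool" where
  "similarity f \<longleftrightarrow> (\<exists>r>0. \<forall>x y. dist (f x) (f y) = r * dist x y)"

text \<open>Finite words over \<open>\<nat>\<close> are lists.  The children of \<open>\<sigma>\<close> are contracted according to the letter
  of the digit sequence \<open>\<omega>\<close> at (0-based) position \<open>length \<sigma>\<close>.\<close>

definition moran_collection ::
    "'a::euclidean_space set \<Rightarrow> ('n \<Rightarrow> nat \<Rightarrow> real) \<Rightarrow> (nat \<Rightarrow> 'n) \<Rightarrow> (nat list \<Rightarrow> 'a set) \<Rightarrow> bool" where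
  "moran_collection J \<gamma> \<omega> S \<longleftrightarrow>
     S [] = J \<and>
     (\<forall>\<sigma>. \<exists>f. similarity f \<and> S \<sigma> = f ` J) \<and>
     (\<forall>\<sigma> j. S (\<sigma> @ [j]) \<subseteq> S \<sigma>) \<and>
     (\<forall>\<sigma> i j. i \<noteq> j \<longrightarrow> interior (S (\<sigma> @ [i])) \<inter> interior (S (\<sigma> @ [j])) = {}) \<and>
     (\<forall>\<sigma> j. diameter (S (\<sigma> @ [j])) / diameter (S \<sigma>) = \<gamma> (\<omega> (length \<sigma>)) j)"

definition moran_fractal :: "(nat list \<Rightarrow> 'a set) \<Rightarrow> 'a set" where
  "moran_fractal S = (\<Union>\<tau> :: nat \<Rightarrow> nat. \<Inter>k\<in>{1..}. S (map \<tau> [0..<k]))"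

text \<open>\<open>\<Delta>(\<eta>)\<close>: the common Hausdorff dimension of all Moran fractals built from digit sequences
  (not necessarily expansions of a number) with frequency vector \<open>\<eta>\<close>.\<close>

definition moran_dim ::
    "'a::euclidean_space set \<Rightarrow> ('n::finite \<Rightarrow> nat \<Rightarrow> real) \<Rightarrow> real^'n \<Rightarrow> real" where
  "moran_dim J \<gamma> \<eta> =
     (THE s. \<forall>\<omega> S. has_frequencies \<omega> \<eta> \<longrightarrow> moran_collection J \<gamma> \<omega> S \<longrightarrow>
                hausdorff_dim (moran_fractal S) = s)"

text \<open>\<open>H(x)\<close>, for a choice \<open>S x\<close> of a Moran collection for each \<open>x\<close>.\<close>

definition dim_fun :: "(real \<Rightarrow> nat list \<Rightarrow> 'a::euclidean_space set) \<Rightarrow> real \<Rightarrow> real" where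
  "dim_fun S x = hausdorff_dim (moran_fractal (S x))"

text \<open>\<open>Z\<^sub>x\<close> is \<open>dim_level_set J \<gamma> (H(x))\<close>.\<close>

definition dim_level_set ::
    "'a::euclidean_space set \<Rightarrow> ('n::finite \<Rightarrow> nat \<Rightarrow> real) \<Rightarrow> real \<Rightarrow> (real^'n) set" where
  "dim_level_set J \<gamma> s = {\<eta> \<in> pos_stochastic. moran_dim J \<gamma> \<eta> = s}"

definition crit_exponent :: "('n::finite \<Rightarrow> nat \<Rightarrow> real) \<Rightarrow> real" where
  "crit_exponent \<gamma> = Max (range (\<lambda>i. Inf {t. 0 < t \<and> summable (\<lambda>j. \<gamma> i j powr t)}))"

definition pressure :: "('n::finite \<Rightarrow> nat \<Rightarrow> real) \<Rightarrow> real^'n \<Rightarrow> real \<Rightarrow> real" where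
  "pressure \<gamma> \<eta> t = (\<Sum>i\<in>UNIV. \<eta> $ i * ln (\<Sum>j. \<gamma> i j powr t))"

end

theory Submission
  imports Defs "HOL-Probability.Infinite_Product_Measure" "HOL-Library.Sublist"
begin

text \<open>
  Let \<open>\<Delta>(\<eta>)\<close> be the dimension of the Moran fractals with frequency vector \<open>\<eta>\<close>, let
  \<open>a i t = ln (\<Sum>j. \<gamma> i j powr t)\<close>, and write \<open>a(t)\<close> for the vector with entries \<open>a i t\<close>.  The pressure
  \<open>P\<^sub>\<eta>(t) = \<eta> \<bullet> a(t)\<close> is strictly decreasing in \<open>t\<close> and linear in \<open>\<eta>\<close>.  Once \<open>\<Delta>(\<eta>)\<close> is known
  to be the zero of \<open>P\<^sub>\<eta>\<close>, a level set \<open>\<Delta> = s\<close> is the intersection of the open simplex with the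
  hyperplane orthogonal to \<open>a(s)\<close>.  It is therefore an analytic subvariety for a trivial reason, and
  the Lojasiewicz type inequality holds with exponent one.

  The dimension formula (\<open>hausdorff_dim_eq_pressure_zero\<close>).  The \<open>t\<close>-th powers of the diameters at
  level \<open>n\<close> add up to \<open>exp (\<Sum>k<n. a (\<omega> k) t) = exp (n (P\<^sub>\<eta>(t) + o(1)))\<close>.  If \<open>P\<^sub>\<eta>(t) < 0\<close> this tends
  to zero and the \<open>t\<close>-dimensional measure vanishes.  If \<open>P\<^sub>\<eta>(t) > 0\<close>, the pressure stays positive after
  discarding all but the first \<open>N\<close> branches of every vector, for large \<open>N\<close>.  The product measure that
  chooses branch \<open>j < N\<close> with probability proportional to \<open>\<gamma> i j powr t\<close> gives every cylinder at most
  a constant times the \<open>t\<close>-th power of its diameter (\<open>cylinder_measure_exists\<close>).  A set of diameter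
  \<open>\<rho>\<close> meets a bounded number of pieces of size about \<open>\<rho>\<close>, because each of these contains a ball of
  comparable size and they have disjoint interiors (\<open>stopping_words_card_bound\<close>).  So the mass
  distribution principle makes the \<open>t\<close>-dimensional measure positive.  The value
  \<open>\<Delta>(\<eta>)\<close> is defined for every \<open>\<eta>\<close> in the simplex, and to pin it down one needs some sequence with
  these frequencies; a greedy choice of letters produces one (\<open>has_frequencies_exists\<close>).

  The inequality (\<open>pressure_root_error_bound\<close>).  Let \<open>\<rho>\<close> lie in the compact set \<open>K\<close> and let
  \<open>s = \<Delta>(p)\<close>.  When \<open>s\<close> is far from \<open>\<Delta>(\<rho>)\<close> the bound holds since the simplex is bounded.  When \<open>s\<close>
  is close to \<open>\<Delta>(\<rho>)\<close>, then \<open>\<bar>P\<^sub>\<rho>(s)\<bar>\<close> is at most a constant times \<open>\<bar>s - \<Delta>(\<rho>)\<bar>\<close>, and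
  moving \<open>\<rho>\<close> towards a vertex of the simplex where \<open>a(s)\<close> has the opposite sign reaches the hyperplane
  after a distance proportional to \<open>\<bar>P\<^sub>\<rho>(s)\<bar>\<close>.  The factor is bounded because that coordinate of
  \<open>a(s)\<close> stays away from zero for \<open>s\<close> near \<open>\<Delta>(K)\<close>.  This argument needs coordinates of both
  signs, and these exist unless \<open>a\<close> vanishes identically at some point; in that case \<open>\<Delta>\<close> is constant.
\<close>


section \<open>Power sums and pressure\<close>

text \<open>The derivative of \<open>s \<mapsto> x powr s\<close> carries a factor \<open>ln x\<close>, unbounded as \<open>x\<close> tends to zero.  Lowering the
  exponent by \<open>h\<close> absorbs it, since \<open>- ln x \<le> x powr (-h) / h\<close>; the resulting bound can be summed over
  infinitely many ratios \<open>x\<close>.\<close>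

lemma powr_diff_le:
  fixes x :: real
  assumes "0 < x" "x \<le> 1" "0 < h" "lo \<le> s" "s \<le> t"
  shows "x powr s - x powr t \<le> (t - s) * (x powr (lo - h) / h)"
proof -
  have l: "ln x \<le> 0" using assms by simp
  have 1: "1 - x powr (t - s) \<le> (t - s) * (- ln x)"
    using exp_ge_add_one_self[of "(t - s) * ln x"] assms
    by (simp only: powr_def) (simp add: algebra_simps)
  have "ln (x powr (-h)) \<le> x powr (-h) - 1" by (rule ln_le_minus_one) (use assms in auto)
  hence "h * (- ln x) \<le> x powr (-h)" using assms by (simp add: ln_powr)
  hence "h * (- ln x) * x powr h \<le> x powr (-h) * x powr h"
    by (intro mult_right_mono) auto
  also have "\<dots> = 1" using assms by (simp flip: powr_add)
  finally have 2: "- ln x * x powr h \<le> 1 / h" using assms by (simp add: field_simps)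
  have "x powr s - x powr t = x powr s * (1 - x powr (t - s))"
    using assms by (simp add: algebra_simps flip: powr_add)
  also have "\<dots> \<le> x powr lo * ((t - s) * (- ln x))"
    using assms 1 by (intro mult_mono powr_mono') (auto intro: powr_le1)
  also have "\<dots> = (t - s) * (x powr (lo - h) * (- ln x * x powr h))"
    using assms by (simp add: algebra_simps flip: powr_add)
  also have "\<dots> \<le> (t - s) * (x powr (lo - h) * (1 / h))"
    using 2 assms by (intro mult_left_mono) auto
  finally show ?thesis by simp
qed

locale contraction_vectors =
  fixes \<gamma> :: "'n::finite \<Rightarrow> nat \<Rightarrow> real"
  assumes pos: "0 < \<gamma> i j"
    and summable_ratios: "summable (\<gamma> i)"
    and uniformly_contracting: "\<exists>c<1. \<forall>i j. \<gamma> i j \<le> c"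
begin

abbreviation "\<theta> \<equiv> crit_exponent \<gamma>"

definition power_sum :: "'n \<Rightarrow> real \<Rightarrow> real" where
  "power_sum i t = (\<Sum>j. \<gamma> i j powr t)"

definition log_sum :: "real \<Rightarrow> real^'n" where
  "log_sum t = (\<chi> i. ln (power_sum i t))"

text \<open>The scalar product form makes the linearity in \<open>\<eta>\<close> visible: for fixed \<open>t\<close> the zero set of the pressure is
  a hyperplane.\<close>

lemma pressure_eq_inner: "pressure \<gamma> \<eta> t = \<eta> \<bullet> log_sum t"
  by (simp add: pressure_def inner_vec_def log_sum_def power_sum_def)

lemma ratio_nonzero: "\<gamma> i j \<noteq> 0"
  using pos[of i j] by simp

lemma less_one: "\<gamma> i j < 1"
  using uniformly_contracting by (meson le_less_trans)

lemma contraction_bound: "\<exists>c. 0 < c \<and> c < 1 \<and> (\<forall>i j. \<gamma> i j \<le> c)"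
proof -
  obtain c where c: "c < 1" "\<And>i j. \<gamma> i j \<le> c" using uniformly_contracting by blast
  from c(2)[of undefined undefined] pos[of undefined undefined] have "0 < c" by linarith
  with c show ?thesis by blast
qed

lemma crit_exponent_nonneg: "0 \<le> \<theta>"
proof -
  have "0 \<le> Inf {t. 0 < t \<and> summable (\<lambda>j. \<gamma> i j powr t)}" for i
    using pos[of i] summable_ratios[of i]
    by (intro cInf_greatest) (auto intro!: exI[of _ 1] simp: less_imp_le)
  also have "Inf {t. 0 < t \<and> summable (\<lambda>j. \<gamma> undefined j powr t)} \<le> \<theta>"
    unfolding crit_exponent_def by (intro Max_ge) auto
  finally show ?thesis .
qed

text \<open>Summability at one exponent gives summability at all larger ones because the ratios are below \<open>1\<close>; so
  each letter's own infimum is a threshold, and \<open>\<theta>\<close> is the largest of them.\<close>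

lemma powr_summable:
  assumes "\<theta> < t"
  shows "summable (\<lambda>j. \<gamma> i j powr t)"
proof -
  let ?A = "{t. 0 < t \<and> summable (\<lambda>j. \<gamma> i j powr t)}"
  have "1 \<in> ?A" using summable_ratios[of i] pos[of i] by (simp add: less_imp_le)
  moreover have "Inf ?A \<le> \<theta>"
    unfolding crit_exponent_def by (intro Max_ge) auto
  hence "Inf ?A < t" using assms by linarith
  ultimately obtain t' where t': "t' \<in> ?A" "t' < t"
    using cInf_lessD[of ?A t] by blast
  show ?thesis
  proof (rule summable_comparison_test)
    show "summable (\<lambda>j. \<gamma> i j powr t')" using t' by simp
    show "\<exists>N. \<forall>n\<ge>N. norm (\<gamma> i n powr t) \<le> \<gamma> i n powr t'"
      using t' less_imp_le[OF pos] less_imp_le[OF less_one] by (auto intro!: powr_mono')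
  qed
qed

lemma power_sum_pos: "\<theta> < t \<Longrightarrow> 0 < power_sum i t"
  unfolding power_sum_def by (intro suminf_pos powr_summable) (simp_all add: ratio_nonzero)

lemma power_sum_strict_antimono:
  assumes "\<theta> < s" "s < t"
  shows "power_sum i t < power_sum i s"
proof -
  have "0 < (\<Sum>j. \<gamma> i j powr s - \<gamma> i j powr t)"
    using assms pos less_one by (intro suminf_pos summable_diff powr_summable) (auto intro!: powr_less_mono')
  also have "\<dots> = power_sum i s - power_sum i t"
    unfolding power_sum_def using assms by (intro suminf_diff[symmetric] powr_summable) auto
  finally show ?thesis by simp
qed

lemma log_sum_strict_antimono:
  "\<theta> < s \<Longrightarrow> s < t \<Longrightarrow> log_sum t $ i < log_sum s $ i"
  using power_sum_strict_antimono[of s t i] power_sum_pos[of t i] power_sum_pos[of s i]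
  by (simp add: log_sum_def)

text \<open>The distance from \<open>\<theta>\<close> to \<open>lo\<close> leaves room to lower the exponent in \<open>powr_diff_le\<close> and still sum.\<close>

lemma power_sum_lipschitz:
  assumes "\<theta> < lo"
  shows "\<exists>L\<ge>0. \<forall>s\<ge>lo. \<forall>t\<ge>s. power_sum i s - power_sum i t \<le> L * (t - s)"
proof -
  define h where "h = (lo - \<theta>) / 2"
  have h: "0 < h" "\<theta> < lo - h" using assms by (auto simp: h_def field_simps)
  have "power_sum i s - power_sum i t \<le> (power_sum i (lo - h) / h) * (t - s)"
    if "lo \<le> s" "s \<le> t" for s t
  proof -
    have "power_sum i s - power_sum i t = (\<Sum>j. \<gamma> i j powr s - \<gamma> i j powr t)"
      unfolding power_sum_def using assms that by (intro suminf_diff powr_summable) auto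
    also have "\<dots> \<le> (\<Sum>j. (t - s) * (\<gamma> i j powr (lo - h) / h))"
      using assms that h pos less_imp_le[OF less_one]
      by (intro suminf_le summable_diff powr_summable summable_mult summable_divide powr_diff_le) auto
    also have "\<dots> = (t - s) * (power_sum i (lo - h) / h)"
      unfolding power_sum_def using h
      by (subst suminf_mult) (simp_all add: summable_divide powr_summable suminf_divide)
    finally show ?thesis by (simp add: mult.commute)
  qed
  moreover have "power_sum i (lo - h) / h \<ge> 0" using h power_sum_pos[of "lo - h" i] by simp
  ultimately show ?thesis by blast
qed

lemma log_sum_lipschitz_component:
  assumes "\<theta> < lo"
  shows "\<exists>L\<ge>0. \<forall>s\<in>{lo..hi}. \<forall>t\<in>{lo..hi}. s \<le> t \<longrightarrow>
           log_sum s $ i - log_sum t $ i \<le> L * (t - s)"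
proof -
  obtain L where L: "L \<ge> 0" "\<And>s t. lo \<le> s \<Longrightarrow> s \<le> t \<Longrightarrow> power_sum i s - power_sum i t \<le> L * (t - s)"
    using power_sum_lipschitz[OF assms, of i] by blast
  let ?m = "power_sum i (max lo hi)"
  have m: "0 < ?m" using assms by (intro power_sum_pos) auto
  have "log_sum s $ i - log_sum t $ i \<le> (L / ?m) * (t - s)"
    if st: "s \<in> {lo..hi}" "t \<in> {lo..hi}" "s \<le> t" for s t
  proof -
    have p: "0 < power_sum i s" "0 < power_sum i t"
      using st assms by (auto intro!: power_sum_pos)
    have mt: "?m \<le> power_sum i t"
      using power_sum_strict_antimono[of t hi i] st assms by (cases "t = hi") (auto simp: max_def)
    have "log_sum s $ i - log_sum t $ i = ln (power_sum i s / power_sum i t)"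
      using p by (simp add: log_sum_def ln_div)
    also have "\<dots> \<le> power_sum i s / power_sum i t - 1"
      by (rule ln_le_minus_one) (use p in simp)
    also have "\<dots> = (power_sum i s - power_sum i t) / power_sum i t"
      using p by (simp add: field_simps)
    also have "\<dots> \<le> (L * (t - s)) / power_sum i t"
      using L(2)[of s t] st p by (intro divide_right_mono) auto
    also have "\<dots> \<le> (L * (t - s)) / ?m"
      using mt m L(1) st by (intro divide_left_mono mult_nonneg_nonneg) (auto intro!: mult_pos_pos p)
    finally show ?thesis by simp
  qed
  moreover have "L / ?m \<ge> 0" using L m by simp
  ultimately show ?thesis by blast
qed

lemma log_sum_lipschitz:
  assumes "\<theta> < lo"
  shows "\<exists>L>0. \<forall>i s t. lo \<le> s \<longrightarrow> s \<le> t \<longrightarrow> t \<le> hi \<longrightarrow>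
           log_sum s $ i - log_sum t $ i \<le> L * (t - s)"
proof -
  have "\<forall>i. \<exists>L\<ge>0. \<forall>s\<in>{lo..hi}. \<forall>t\<in>{lo..hi}. s \<le> t \<longrightarrow> log_sum s $ i - log_sum t $ i \<le> L * (t - s)"
    using log_sum_lipschitz_component[OF assms] by blast
  then obtain L where L: "\<And>i. L i \<ge> 0"
    "\<And>i s t. s\<in>{lo..hi} \<Longrightarrow> t\<in>{lo..hi} \<Longrightarrow> s \<le> t \<Longrightarrow> log_sum s $ i - log_sum t $ i \<le> L i * (t - s)"
    by metis
  have Li: "L i \<le> sum L UNIV + 1" for i using member_le_sum[of i UNIV L] L(1) by auto
  have "log_sum s $ i - log_sum t $ i \<le> (sum L UNIV + 1) * (t - s)"
    if "lo \<le> s" "s \<le> t" "t \<le> hi" for s t i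
  proof -
    have "log_sum s $ i - log_sum t $ i \<le> L i * (t - s)" using L(2)[of s t i] that by auto
    also have "\<dots> \<le> (sum L UNIV + 1) * (t - s)" using that Li by (intro mult_right_mono) auto
    finally show ?thesis .
  qed
  moreover have "0 < sum L UNIV + 1" using sum_nonneg[of UNIV L] L(1) by (smt (verit))
  ultimately show ?thesis by blast
qed

lemma isCont_log_sum: "\<theta> < t \<Longrightarrow> isCont (\<lambda>t. log_sum t $ i) t"
proof -
  assume t: "\<theta> < t"
  define lo where "lo = (\<theta> + t) / 2"
  have lo: "\<theta> < lo" "lo < t" using t by (auto simp: lo_def)
  obtain L where L: "0 < L"
    "\<And>s u i. lo \<le> s \<Longrightarrow> s \<le> u \<Longrightarrow> u \<le> t + 1 \<Longrightarrow> log_sum s $ i - log_sum u $ i \<le> L * (u - s)"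
    using log_sum_lipschitz[OF lo(1), of "t + 1"] by metis
  have "L-lipschitz_on {lo..t+1} (\<lambda>t. log_sum t $ i)"
  proof (rule lipschitz_onI)
    have *: "dist (log_sum s $ i) (log_sum u $ i) \<le> L * dist s u"
      if "s \<in> {lo..t+1}" "u \<in> {lo..t+1}" "s \<le> u" for s u
      using L(2)[of s u i] log_sum_strict_antimono[of s u i] lo that
      by (cases "s = u") (auto simp: dist_real_def)
    show "dist (log_sum s $ i) (log_sum u $ i) \<le> L * dist s u"
      if "s \<in> {lo..t+1}" "u \<in> {lo..t+1}" for s u
      using *[of s u] *[of u s] that by (cases "s \<le> u") (auto simp: dist_commute)
  qed (use L in simp)
  hence "continuous_on {lo..t+1} (\<lambda>t. log_sum t $ i)" by (rule lipschitz_on_continuous_on)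
  thus ?thesis by (rule continuous_on_interior) (use lo in auto)
qed

text \<open>With all ratios at most \<open>c < 1\<close>, raising the exponent by \<open>t\<close> costs a factor \<open>c powr t\<close>, which eventually
  beats the fixed sums at the exponent \<open>\<theta> + 1\<close>.\<close>

lemma log_sum_eventually_negative: "\<exists>t>\<theta>. \<forall>i. log_sum t $ i < 0"
proof -
  obtain c where c: "0 < c" "c < 1" "\<And>i j. \<gamma> i j \<le> c" using contraction_bound by metis
  define u where "u = \<theta> + 1"
  have "((\<lambda>t. c powr t * power_sum i u) \<longlongrightarrow> 0) at_top" for i
  proof (intro tendsto_mult_left_zero)
    have "LIM t at_top. ln c * t :> at_bot"
      using c by (intro filterlim_tendsto_neg_mult_at_bot[OF tendsto_const _ filterlim_ident]) auto
    hence "((\<lambda>t. exp (ln c * t)) \<longlongrightarrow> 0) at_top"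
      by (rule filterlim_compose[OF exp_at_bot])
    thus "((\<lambda>t. c powr t) \<longlongrightarrow> 0) at_top"
      using c by (simp add: powr_def mult.commute)
  qed
  hence "eventually (\<lambda>t. c powr t * power_sum i u < 1) at_top" for i
    by (rule order_tendstoD(2)) simp
  hence "eventually (\<lambda>t. \<forall>i. c powr t * power_sum i u < 1) at_top"
    by (rule eventually_all_finite)
  hence "eventually (\<lambda>t. 0 < t \<and> (\<forall>i. c powr t * power_sum i u < 1)) at_top"
    by (intro eventually_conj eventually_gt_at_top)
  then obtain t where t: "0 < t" "\<And>i. c powr t * power_sum i u < 1"
    using eventually_happens by force
  have "power_sum i (t + u) \<le> c powr t * power_sum i u" for i
  proof -
    have "power_sum i (t + u) \<le> (\<Sum>j. c powr t * \<gamma> i j powr u)"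
      unfolding power_sum_def
      using t(1) c(3) less_imp_le[OF pos]
      by (intro suminf_le summable_mult powr_summable)
         (auto simp: powr_add u_def intro!: mult_right_mono powr_mono2)
    also have "\<dots> = c powr t * power_sum i u"
      unfolding power_sum_def by (intro suminf_mult powr_summable) (simp add: u_def)
    finally show ?thesis .
  qed
  hence "power_sum i (t + u) < 1" for i using t(2) by (meson le_less_trans)
  moreover have th: "\<theta> < t + u" using t by (simp add: u_def)
  ultimately have "\<forall>i. log_sum (t + u) $ i < 0" using power_sum_pos by (simp add: log_sum_def)
  with th show ?thesis by blast
qed

lemma pressure_strict_antimono:
  assumes "\<eta> \<in> pos_stochastic" "\<theta> < s" "s < t"
  shows "pressure \<gamma> \<eta> t < pressure \<gamma> \<eta> s"
  unfolding pressure_eq_inner inner_vec_def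
  using assms log_sum_strict_antimono
  by (intro sum_strict_mono) (auto simp: pos_stochastic_def intro!: mult_strict_left_mono)

lemma pressure_zero_unique:
  assumes "\<eta> \<in> pos_stochastic" "\<theta> < s" "\<theta> < t" "pressure \<gamma> \<eta> s = 0" "pressure \<gamma> \<eta> t = 0"
  shows "s = t"
  using pressure_strict_antimono[OF assms(1), of s t] pressure_strict_antimono[OF assms(1), of t s] assms
  by (metis less_irrefl linorder_neqE)

lemma pressure_zero_exists:
  assumes \<eta>: "\<eta> \<in> pos_stochastic" and u: "\<theta> < u" "0 < pressure \<gamma> \<eta> u"
  shows "\<exists>s>\<theta>. pressure \<gamma> \<eta> s = 0"
proof -
  obtain t where t: "\<theta> < t" "\<And>i. log_sum t $ i < 0" using log_sum_eventually_negative by blast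
  have "pressure \<gamma> \<eta> t < 0"
    unfolding pressure_eq_inner inner_vec_def
    using sum_strict_mono[of UNIV "\<lambda>i. \<eta> $ i * log_sum t $ i" "\<lambda>_. 0"] \<eta> t
    by (simp add: pos_stochastic_def mult_pos_neg)
  moreover from this have "u < t"
    using pressure_strict_antimono[OF \<eta> t(1), of u] u by (cases u t rule: linorder_cases) auto
  moreover have "isCont (pressure \<gamma> \<eta>) s" if "u \<le> s" "s \<le> t" for s
    unfolding pressure_eq_inner inner_vec_def inner_real_def
    using that u by (intro continuous_sum continuous_mult continuous_const isCont_log_sum) auto
  ultimately obtain s where "u \<le> s" "s \<le> t" "pressure \<gamma> \<eta> s = 0"
    using IVT2[of "pressure \<gamma> \<eta>" t 0 u] u by auto
  with u show ?thesis by (intro exI[of _ s]) auto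
qed

end

section \<open>Hausdorff measure and dimension\<close>

lemma hausdorff_measure_eq_0_iff:
  "hausdorff_measure s E = 0 \<longleftrightarrow> (\<forall>\<delta>>0. hausdorff_premeasure s \<delta> E = 0)"
proof -
  have "hausdorff_measure s E = 0 \<longleftrightarrow> hausdorff_measure s E \<le> 0" by simp
  also have "\<dots> \<longleftrightarrow> (\<forall>\<delta>>0. hausdorff_premeasure s \<delta> E \<le> 0)"
    unfolding hausdorff_measure_def SUP_le_iff by auto
  finally show ?thesis by simp
qed

lemma hausdorff_premeasure_antimono_delta:
  assumes "\<delta> \<le> \<delta>'"
  shows "hausdorff_premeasure s \<delta>' E \<le> hausdorff_premeasure s \<delta> E"
  unfolding hausdorff_premeasure_def by (rule Inf_superset_mono) (blast intro: order_trans[OF _ assms])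

lemma hausdorff_premeasure_antimono_exponent:
  assumes "s \<le> t" "\<delta> \<le> 1"
  shows "hausdorff_premeasure t \<delta> E \<le> hausdorff_premeasure s \<delta> E"
  unfolding hausdorff_premeasure_def
proof (rule Inf_mono, safe)
  fix U :: "nat \<Rightarrow> 'a set"
  assume U: "E \<subseteq> (\<Union>k. U k)" "\<forall>k. bounded (U k) \<and> diameter (U k) \<le> \<delta>"
  have "(\<Sum>k. ennreal (diameter (U k) powr t)) \<le> (\<Sum>k. ennreal (diameter (U k) powr s))"
  proof (intro suminf_le ennreal_leI powr_mono')
    show "0 \<le> diameter (U k)" for k using U(2) diameter_ge_0 by blast
    show "diameter (U k) \<le> 1" for k using U(2) assms by (meson order_trans)
  qed (use assms in auto)
  thus "\<exists>a\<in>{(\<Sum>k. ennreal (diameter (U k) powr t)) | U :: nat \<Rightarrow> 'a set.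
            E \<subseteq> (\<Union>k. U k) \<and> (\<forall>k. bounded (U k) \<and> diameter (U k) \<le> \<delta>)}.
          a \<le> (\<Sum>k. ennreal (diameter (U k) powr s))"
    using U by blast
qed

lemma hausdorff_measure_zero_mono:
  assumes "hausdorff_measure s E = 0" "s \<le> t"
  shows "hausdorff_measure t E = 0"
  unfolding hausdorff_measure_eq_0_iff
proof (intro allI impI)
  fix \<delta> :: real assume "0 < \<delta>"
  have "hausdorff_premeasure t \<delta> E \<le> hausdorff_premeasure t (min \<delta> 1) E"
    by (rule hausdorff_premeasure_antimono_delta) simp
  also have "\<dots> \<le> hausdorff_premeasure s (min \<delta> 1) E"
    by (rule hausdorff_premeasure_antimono_exponent) (use assms in auto)
  also have "\<dots> = 0" using assms(1) \<open>0 < \<delta>\<close> by (simp add: hausdorff_measure_eq_0_iff)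
  finally show "hausdorff_premeasure t \<delta> E = 0" by simp
qed

text \<open>Covers in the definition are sequences; words of a given length form a countably infinite index set, for
  which the sum is written as an integral against counting measure.\<close>

lemma hausdorff_premeasure_le_countable_cover:
  fixes U :: "'b \<Rightarrow> 'a::metric_space set"
  assumes "countable A" "infinite A" and cover: "E \<subseteq> (\<Union>a\<in>A. U a)"
    and small: "\<And>a. a \<in> A \<Longrightarrow> bounded (U a) \<and> diameter (U a) \<le> \<delta>"
  shows "hausdorff_premeasure s \<delta> E \<le> (\<integral>\<^sup>+a. ennreal (diameter (U a) powr s) \<partial>count_space A)"
proof -
  have bij: "bij_betw (from_nat_into A) UNIV A"
    using assms by (intro bij_betw_from_nat_into)
  have "hausdorff_premeasure s \<delta> E \<le> (\<Sum>k. ennreal (diameter (U (from_nat_into A k)) powr s))"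
    unfolding hausdorff_premeasure_def
  proof (rule Inf_lower, intro CollectI exI[of _ "\<lambda>k. U (from_nat_into A k)"] conjI refl allI)
    have "A = range (from_nat_into A)" using bij by (simp add: bij_betw_def)
    thus "E \<subseteq> (\<Union>k. U (from_nat_into A k))" using cover by (metis UN_extend_simps(10))
    have "from_nat_into A k \<in> A" for k using bij by (auto simp: bij_betw_def)
    thus "bounded (U (from_nat_into A k))" "diameter (U (from_nat_into A k)) \<le> \<delta>" for k
      using small by blast+
  qed
  also have "\<dots> = (\<integral>\<^sup>+k. ennreal (diameter (U (from_nat_into A k)) powr s) \<partial>count_space UNIV)"
    by (rule nn_integral_count_space_nat[symmetric])
  also have "\<dots> = (\<integral>\<^sup>+a. ennreal (diameter (U a) powr s) \<partial>count_space A)"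
    by (rule nn_integral_bij_count_space[OF bij])
  finally show ?thesis .
qed

text \<open>Lower bounds on Hausdorff measure come from a measure that gives little mass to small sets.  The measure
  lives on a space that \<open>\<pi>\<close> maps into \<open>E\<close> and is not pushed forward, so \<open>\<pi>\<close> may be an arbitrary map:
  measurable sets that enclose the preimages of small sets are enough for countable subadditivity.\<close>

lemma mass_distribution_principle:
  assumes "prob_space M" and into: "\<And>x. x \<in> space M \<Longrightarrow> \<pi> x \<in> E"
    and "0 < \<delta>" "0 < C"
    and bound: "\<And>U. bounded U \<Longrightarrow> diameter U \<le> \<delta> \<Longrightarrow>
       \<exists>A\<in>sets M. \<pi> -` U \<inter> space M \<subseteq> A \<and> emeasure M A \<le> ennreal (C * diameter U powr t)"
  shows "hausdorff_measure t E \<noteq> 0"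
proof
  interpret prob_space M by fact
  assume "hausdorff_measure t E = 0"
  hence "hausdorff_premeasure t \<delta> E < ennreal (1 / C)"
    using assms by (simp add: hausdorff_measure_eq_0_iff)
  then obtain U :: "nat \<Rightarrow> _ set" where U: "E \<subseteq> (\<Union>k. U k)" "\<And>k. bounded (U k) \<and> diameter (U k) \<le> \<delta>"
    and sum: "(\<Sum>k. ennreal (diameter (U k) powr t)) < ennreal (1 / C)"
    unfolding hausdorff_premeasure_def Inf_less_iff by blast
  have "\<forall>k. \<exists>A\<in>sets M. \<pi> -` U k \<inter> space M \<subseteq> A \<and> emeasure M A \<le> ennreal (C * diameter (U k) powr t)"
    using bound U(2) by blast
  then obtain A where A: "\<And>k. A k \<in> sets M" "\<And>k. \<pi> -` U k \<inter> space M \<subseteq> A k"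
    "\<And>k. emeasure M (A k) \<le> ennreal (C * diameter (U k) powr t)"
    by metis
  have "space M \<subseteq> (\<Union>k. A k)" using into U(1) A(2) by blast
  hence "1 \<le> emeasure M (\<Union>k. A k)"
    using emeasure_mono[of "space M" "\<Union>k. A k" M] A(1) emeasure_space_1 by auto
  also have "\<dots> \<le> (\<Sum>k. emeasure M (A k))"
    by (rule emeasure_subadditive_countably) (use A(1) in auto)
  also have "\<dots> \<le> (\<Sum>k. ennreal C * ennreal (diameter (U k) powr t))"
    using A(3) assms by (intro suminf_le) (auto simp flip: ennreal_mult')
  also have "\<dots> = ennreal C * (\<Sum>k. ennreal (diameter (U k) powr t))" by simp
  also have "\<dots> < ennreal C * ennreal (1 / C)"
    using sum \<open>0 < C\<close> by (intro ennreal_mult_strict_left_mono) auto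
  also have "\<dots> = 1" using \<open>0 < C\<close> by (simp flip: ennreal_mult')
  finally show False by simp
qed

lemma hausdorff_dim_eqI:
  assumes "0 \<le> \<theta>" "\<theta> < s"
    and upper: "\<And>t. s < t \<Longrightarrow> hausdorff_measure t E = 0"
    and lower: "\<And>t. \<theta> < t \<Longrightarrow> t < s \<Longrightarrow> hausdorff_measure t E \<noteq> 0"
  shows "hausdorff_dim E = s"
  unfolding hausdorff_dim_def
proof (rule cInf_eq_non_empty)
  show "{s. 0 < s \<and> hausdorff_measure s E = 0} \<noteq> {}"
    using upper[of "s + 1"] assms by (auto intro!: exI[of _ "s + 1"])
next
  fix t assume t: "t \<in> {s. 0 < s \<and> hausdorff_measure s E = 0}"
  show "s \<le> t"
  proof (rule ccontr)
    assume "\<not> s \<le> t"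
    then obtain u where "max \<theta> t < u" "u < s" using dense[of "max \<theta> t" s] assms by auto
    moreover from this t have "hausdorff_measure u E = 0"
      using hausdorff_measure_zero_mono[of t E u] by auto
    ultimately show False using lower[of u] by simp
  qed
next
  fix y assume y: "\<And>t. t \<in> {s. 0 < s \<and> hausdorff_measure s E = 0} \<Longrightarrow> y \<le> t"
  show "y \<le> s"
  proof (rule dense_ge)
    fix t assume "s < t"
    thus "y \<le> t" using y[of t] upper[of t] assms by simp
  qed
qed

section \<open>Digit sequences with prescribed frequencies\<close>

lemma card_occurrences_Suc:
  "card {k. k < Suc n \<and> \<omega> k = i} = card {k. k < n \<and> \<omega> k = i} + (if \<omega> n = i then 1 else 0)"
proof -
  have "{k. k < Suc n \<and> \<omega> k = i} =
      (if \<omega> n = i then insert n {k. k < n \<and> \<omega> k = i} else {k. k < n \<and> \<omega> k = i})"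
    by (auto simp: less_Suc_eq)
  thus ?thesis by auto
qed

text \<open>Greedy choice: append a letter whose count would otherwise fall below its expected value \<open>(n + 1) \<eta>\<^sub>i\<close>.
  Such a letter always exists, and no count then exceeds its expected value by more than \<open>1\<close>.\<close>

lemma low_discrepancy_sequence:
  fixes \<eta> :: "real^'n::finite"
  assumes \<eta>: "\<And>i. 0 \<le> \<eta> $ i" "(\<Sum>i\<in>UNIV. \<eta> $ i) = 1"
  shows "\<exists>\<omega>. \<forall>n i. real (card {k. k < n \<and> \<omega> k = i}) \<le> real n * \<eta> $ i + 1"
proof -
  define good where "good n c \<longleftrightarrow>
    (\<Sum>i\<in>UNIV. c i) = n \<and> (\<forall>i. real (c i) \<le> real n * \<eta> $ i + 1)" for n and c :: "'n \<Rightarrow> nat"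
  have "\<exists>c. \<forall>n. good n (c n) \<and> (\<exists>i. c (Suc n) = (c n)(i := Suc (c n i)))"
  proof (rule dependent_nat_choice)
    show "\<exists>c. good 0 c" by (rule exI[of _ "\<lambda>_. 0"]) (simp add: good_def)
  next
    fix c n assume c: "good n c"
    \<comment> \<open>The deficits \<open>(n + 1) \<eta>\<^sub>i - c\<^sub>i\<close> add up to \<open>1\<close>, so one of them is positive.\<close>
    have "\<exists>i. real (c i) < real (Suc n) * \<eta> $ i"
    proof (rule ccontr)
      assume "\<not> ?thesis"
      hence "(\<Sum>i\<in>UNIV. real (Suc n) * \<eta> $ i) \<le> (\<Sum>i\<in>UNIV. real (c i))"
        by (intro sum_mono) (auto simp: not_less)
      also have "\<dots> = real n" using c by (simp add: good_def flip: of_nat_sum)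
      finally show False using \<eta>(2) by (simp flip: sum_distrib_left)
    qed
    then obtain i where i: "real (c i) < real (Suc n) * \<eta> $ i" ..
    have "good (Suc n) (c(i := Suc (c i)))"
      unfolding good_def
    proof (intro conjI allI)
      have "(\<Sum>j\<in>UNIV. (c(i := Suc (c i))) j) = Suc (c i) + (\<Sum>j\<in>UNIV - {i}. c j)"
        by (subst sum.remove[of _ i]) auto
      also have "\<dots> = Suc (\<Sum>j\<in>UNIV. c j)" by (subst sum.remove[of UNIV i]) auto
      finally show "(\<Sum>j\<in>UNIV. (c(i := Suc (c i))) j) = Suc n" using c by (simp add: good_def)
    next
      fix j
      have "real (c j) \<le> real n * \<eta> $ j + 1" using c by (simp add: good_def)
      thus "real ((c(i := Suc (c i))) j) \<le> real (Suc n) * \<eta> $ j + 1"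
        using i \<eta>(1)[of j] by (auto simp: algebra_simps)
    qed
    thus "\<exists>d. good (Suc n) d \<and> (\<exists>i. d = c(i := Suc (c i)))" by blast
  qed
  then obtain c where c: "\<And>n. good n (c n)" "\<forall>n. \<exists>i. c (Suc n) = (c n)(i := Suc (c n i))"
    by blast
  from c(2) obtain \<omega> where \<omega>: "\<And>n. c (Suc n) = (c n)(\<omega> n := Suc (c n (\<omega> n)))" by metis
  have "card {k. k < n \<and> \<omega> k = i} = c n i" for n i
  proof (induction n)
    case 0
    show ?case using c(1)[of 0] by (simp add: good_def)
  next
    case (Suc n)
    show ?case using Suc \<omega>[of n] by (simp add: card_occurrences_Suc)
  qed
  thus ?thesis using c(1) by (intro exI[of _ \<omega>]) (simp add: good_def)
qed

lemma sum_occurrences: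
  fixes \<omega> :: "nat \<Rightarrow> 'n::finite"
  shows "(\<Sum>i\<in>UNIV. f i * real (card {k. k < n \<and> \<omega> k = i})) = (\<Sum>k<n. f (\<omega> k))"
proof (induction n)
  case (Suc n)
  have "(\<Sum>i\<in>UNIV. f i * real (if \<omega> n = i then 1 else 0)) = f (\<omega> n)"
    by (simp add: if_distrib cong: if_cong)
  thus ?case using Suc by (simp add: card_occurrences_Suc distrib_left sum.distrib)
qed simp

text \<open>Upper bounds on all counts also bound each of them from below, since the counts add up to \<open>n\<close>.\<close>

lemma has_frequencies_exists:
  fixes \<eta> :: "real^'n::finite"
  assumes \<eta>: "\<eta> \<in> pos_stochastic"
  shows "\<exists>\<omega>. has_frequencies \<omega> \<eta>"
proof -
  have pos: "\<And>i. 0 \<le> \<eta> $ i" and sum1: "(\<Sum>i\<in>UNIV. \<eta> $ i) = 1"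
    using \<eta> by (auto simp: pos_stochastic_def less_imp_le)
  obtain \<omega> where \<omega>: "\<And>n i. real (card {k. k < n \<and> \<omega> k = i}) \<le> real n * \<eta> $ i + 1"
    using low_discrepancy_sequence[OF pos sum1] by blast
  have lower: "real n * \<eta> $ i - real CARD('n) \<le> real (card {k. k < n \<and> \<omega> k = i})" for n i
  proof -
    let ?c = "\<lambda>i. real (card {k. k < n \<and> \<omega> k = i})"
    have "real n = (\<Sum>j\<in>UNIV. ?c j)" using sum_occurrences[of "\<lambda>_. 1" n \<omega>] by simp
    also have "\<dots> = ?c i + (\<Sum>j\<in>UNIV - {i}. ?c j)" by (subst sum.remove[of _ i]) auto
    also have "(\<Sum>j\<in>UNIV - {i}. ?c j) \<le> (\<Sum>j\<in>UNIV - {i}. real n * \<eta> $ j + 1)"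
      by (intro sum_mono \<omega>)
    also have "\<dots> \<le> (\<Sum>j\<in>UNIV - {i}. real n * \<eta> $ j) + real CARD('n)"
      by (simp add: sum.distrib card_Diff_singleton)
    also have "(\<Sum>j\<in>UNIV - {i}. real n * \<eta> $ j) = real n - real n * \<eta> $ i"
      using sum.remove[of UNIV i "\<lambda>j. real n * \<eta> $ j"] sum1 by (simp flip: sum_distrib_left)
    finally show ?thesis by simp
  qed
  have "(\<lambda>n. real (card {k. k < n \<and> \<omega> k = i}) / real n) \<longlonglongrightarrow> \<eta> $ i" for i
  proof (rule tendsto_sandwich)
    show "eventually (\<lambda>n. \<eta> $ i - real CARD('n) / real n \<le> real (card {k. k < n \<and> \<omega> k = i}) / real n) sequentially"
      using eventually_gt_at_top[of 0]
    proof eventually_elim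
      case (elim n)
      have "\<eta> $ i - real CARD('n) / real n = (real n * \<eta> $ i - real CARD('n)) / real n"
        using elim by (simp add: diff_divide_distrib)
      also have "\<dots> \<le> real (card {k. k < n \<and> \<omega> k = i}) / real n"
        by (intro divide_right_mono lower) simp
      finally show ?case .
    qed
    show "eventually (\<lambda>n. real (card {k. k < n \<and> \<omega> k = i}) / real n \<le> \<eta> $ i + 1 / real n) sequentially"
      using eventually_gt_at_top[of 0]
    proof eventually_elim
      case (elim n)
      have "real (card {k. k < n \<and> \<omega> k = i}) / real n \<le> (real n * \<eta> $ i + 1) / real n"
        by (intro divide_right_mono \<omega>) simp
      also have "\<dots> = \<eta> $ i + 1 / real n"
        using elim by (simp add: add_divide_distrib)
      finally show ?case .
    qed
    show "(\<lambda>n. \<eta> $ i - real CARD('n) / real n) \<longlonglongrightarrow> \<eta> $ i"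
      using tendsto_diff[OF tendsto_const[of "\<eta> $ i"] lim_const_over_n[of "real CARD('n)"]] by simp
    show "(\<lambda>n. \<eta> $ i + 1 / real n) \<longlonglongrightarrow> \<eta> $ i"
      using tendsto_add[OF tendsto_const[of "\<eta> $ i"] lim_const_over_n[of 1]] by simp
  qed
  thus ?thesis by (auto simp: has_frequencies_def)
qed

text \<open>Grouping the terms of the average by letter turns it into a finite combination of letter frequencies.\<close>

lemma digit_average_tendsto:
  assumes "has_frequencies \<omega> \<eta>"
  shows "(\<lambda>n. (\<Sum>k<n. f (\<omega> k)) / real n) \<longlonglongrightarrow> (\<Sum>i\<in>UNIV. \<eta> $ i * f i)"
proof -
  have "(\<lambda>n. \<Sum>i\<in>UNIV. real (card {k. k < n \<and> \<omega> k = i}) / real n * f i)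
      \<longlonglongrightarrow> (\<Sum>i\<in>UNIV. \<eta> $ i * f i)"
    using assms by (intro tendsto_intros) (auto simp: has_frequencies_def)
  also have "(\<lambda>n. \<Sum>i\<in>UNIV. real (card {k. k < n \<and> \<omega> k = i}) / real n * f i) =
      (\<lambda>n. (\<Sum>k<n. f (\<omega> k)) / real n)"
    by (rule ext) (simp add: sum_divide_distrib mult.commute flip: sum_occurrences)
  finally show ?thesis .
qed

section \<open>Similarities and packings of balls\<close>

text \<open>The range is open by invariance of domain and closed by completeness, hence everything.\<close>

lemma scaling_map_surj:
  fixes f :: "'a::euclidean_space \<Rightarrow> 'a"
  assumes r: "0 < r" and f: "\<And>x y. dist (f x) (f y) = r * dist x y"
  shows "surj f"
proof -
  have cont: "continuous_on UNIV f"
    by (rule lipschitz_on_continuous_on[of r]) (use r f in \<open>auto intro!: lipschitz_onI\<close>)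
  have "inj f"
  proof (rule injI)
    fix x y assume "f x = f y"
    thus "x = y" using f[of x y] r by simp
  qed
  hence "open (range f)" using cont by (intro invariance_of_domain) auto
  moreover have "closed (range f)"
    unfolding closed_sequential_limits
  proof (intro allI impI, elim conjE)
    fix y l assume y: "\<forall>n. y n \<in> range f" and lim: "y \<longlonglongrightarrow> l"
    have "\<forall>n. \<exists>x. y n = f x" using y by blast
    then obtain x where x: "\<And>n. y n = f (x n)" by metis
    have "Cauchy x"
    proof (rule metric_CauchyI)
      fix e :: real assume "0 < e"
      hence "0 < r * e" using r by simp
      then obtain M where "\<forall>m\<ge>M. \<forall>n\<ge>M. dist (y m) (y n) < r * e"
        using LIMSEQ_imp_Cauchy[OF lim] metric_CauchyD by blast
      thus "\<exists>M. \<forall>m\<ge>M. \<forall>n\<ge>M. dist (x m) (x n) < e"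
        using r by (auto simp: x f)
    qed
    then obtain x0 where "x \<longlonglongrightarrow> x0" using Cauchy_convergent convergent_def by blast
    hence "(\<lambda>n. f (x n)) \<longlonglongrightarrow> f x0"
      using cont by (intro isCont_tendsto_compose[of x0 f]) (auto simp: continuous_on_eq_continuous_at)
    hence "l = f x0" using lim x by (metis (no_types, lifting) LIMSEQ_unique ext)
    thus "l \<in> range f" by simp
  qed
  ultimately show ?thesis using clopen[of "range f"] by auto
qed

lemma scaling_map_image_ball:
  fixes f :: "'a::euclidean_space \<Rightarrow> 'a"
  assumes r: "0 < r" and f: "\<And>x y. dist (f x) (f y) = r * dist x y"
  shows "f ` ball x \<rho> = ball (f x) (r * \<rho>)"
proof -
  have "y \<in> f ` ball x \<rho>" if "y \<in> ball (f x) (r * \<rho>)" for y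
  proof -
    obtain z where "y = f z" using scaling_map_surj[OF r f] by (metis surjD)
    with that r f[of x z] show ?thesis by auto
  qed
  thus ?thesis using r f by auto
qed

lemma scaling_map_diameter:
  fixes f :: "'a::metric_space \<Rightarrow> 'b::metric_space"
  assumes r: "0 < r" and f: "\<And>x y. dist (f x) (f y) = r * dist x y"
    and J: "compact J" "J \<noteq> {}"
  shows "diameter (f ` J) = r * diameter J"
proof (rule antisym)
  have cont: "continuous_on J f"
    by (rule lipschitz_on_continuous_on[of r]) (use r f in \<open>auto intro!: lipschitz_onI\<close>)
  hence comp: "compact (f ` J)" using J(1) by (rule compact_continuous_image)
  obtain a b where ab: "a \<in> f ` J" "b \<in> f ` J" "dist a b = diameter (f ` J)"
    using diameter_compact_attained[OF comp] J by blast
  then obtain x y where xy: "x \<in> J" "y \<in> J" "a = f x" "b = f y" by blast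
  show "diameter (f ` J) \<le> r * diameter J"
    using ab(3) xy f[of x y] r
      mult_left_mono[OF diameter_bounded_bound[OF compact_imp_bounded[OF J(1)] xy(1,2)], of r] by simp
  obtain x y where xy: "x \<in> J" "y \<in> J" "dist x y = diameter J"
    using diameter_compact_attained[OF J] by blast
  thus "r * diameter J \<le> diameter (f ` J)"
    using diameter_bounded_bound[OF compact_imp_bounded[OF comp], of "f x" "f y"] f[of x y] by simp
qed

text \<open>Comparison of volumes.\<close>

lemma disjoint_balls_card_le:
  fixes x :: "'b \<Rightarrow> 'a::euclidean_space"
  assumes W: "finite W" "disjoint_family_on (\<lambda>w. ball (x w) r) W"
    and sub: "\<And>w. w \<in> W \<Longrightarrow> ball (x w) r \<subseteq> cball u R"
    and "0 < r" "0 \<le> R"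
  shows "real (card W) \<le> (R / r) ^ DIM('a)"
proof -
  let ?V = "unit_ball_vol (real DIM('a))"
  have V: "0 < ?V" by simp
  have "ennreal (real (card W) * (?V * r ^ DIM('a))) = (\<Sum>w\<in>W. emeasure lborel (ball (x w) r))"
    using \<open>0 < r\<close> V by (simp add: emeasure_ball ennreal_mult' flip: ennreal_of_nat_eq_real_of_nat)
  also have "\<dots> = emeasure lborel (\<Union>w\<in>W. ball (x w) r)"
    by (rule sum_emeasure) (use W in auto)
  also have "\<dots> \<le> emeasure lborel (cball u R)"
    by (intro emeasure_mono) (use sub in auto)
  also have "\<dots> = ennreal (?V * R ^ DIM('a))" using \<open>0 \<le> R\<close> by (simp add: emeasure_cball)
  finally have "real (card W) * (?V * r ^ DIM('a)) \<le> ?V * R ^ DIM('a)"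
    using V \<open>0 \<le> R\<close> by (subst (asm) ennreal_le_iff) auto
  thus ?thesis using V \<open>0 < r\<close> by (simp add: power_divide field_simps)
qed

section \<open>Moran constructions and their natural covers\<close>

text \<open>Distributivity for products of infinite sums: expanding \<open>\<Prod>k<n. \<Sum>j. g k j\<close> yields one term for each word of
  length \<open>n\<close>.  The induction peels off the last letter and uses Tonelli's theorem for counting measure.\<close>

lemma nn_integral_words_prod:
  fixes g :: "nat \<Rightarrow> nat \<Rightarrow> ennreal"
  shows "(\<integral>\<^sup>+\<sigma>. (\<Prod>k<n. g k (\<sigma> ! k)) \<partial>count_space {\<sigma>. length \<sigma> = n}) = (\<Prod>k<n. \<Sum>j. g k j)"
proof -
  define F where "F n \<sigma> = (if length \<sigma> = n then \<Prod>k<n. g k (\<sigma> ! k) else 0)" for n \<sigma>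
  have F_snoc: "F (Suc n) (\<sigma> @ [j]) = F n \<sigma> * g n j" for n \<sigma> j
    by (auto simp: F_def nth_append intro!: prod.cong arg_cong2[of _ _ _ _ "(*)"])
  have bij: "bij_betw (\<lambda>(\<sigma>, j). \<sigma> @ [j]) UNIV (UNIV - {[] :: nat list})"
    by (rule bij_betw_byWitness[where f' = "\<lambda>\<sigma>. (butlast \<sigma>, last \<sigma>)"]) auto
  have "(\<integral>\<^sup>+\<sigma>. F n \<sigma> \<partial>count_space UNIV) = (\<Prod>k<n. \<Sum>j. g k j)"
  proof (induction n)
    case 0
    have "(\<integral>\<^sup>+\<sigma>. F 0 \<sigma> \<partial>count_space UNIV) = (\<integral>\<^sup>+\<sigma>. F 0 \<sigma> \<partial>count_space {[]})"
      by (rule nn_integral_count_space_eq) (auto simp: F_def)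
    thus ?case by (simp add: F_def nn_integral_count_space_finite)
  next
    case (Suc n)
    have "(\<integral>\<^sup>+\<sigma>. F (Suc n) \<sigma> \<partial>count_space UNIV) = (\<integral>\<^sup>+\<sigma>. F (Suc n) \<sigma> \<partial>count_space (UNIV - {[]}))"
      by (rule nn_integral_count_space_eq) (auto simp: F_def)
    also have "\<dots> = (\<integral>\<^sup>+p. F (Suc n) (case p of (\<sigma>, j) \<Rightarrow> \<sigma> @ [j]) \<partial>count_space UNIV)"
      by (rule nn_integral_bij_count_space[OF bij, symmetric])
    also have "\<dots> = (\<integral>\<^sup>+p. (case p of (\<sigma>, j) \<Rightarrow> F n \<sigma> * g n j) \<partial>count_space UNIV)"
      by (rule nn_integral_cong) (auto simp: F_snoc)
    also have "\<dots> = (\<integral>\<^sup>+\<sigma>. \<integral>\<^sup>+j. F n \<sigma> * g n j \<partial>count_space UNIV \<partial>count_space UNIV)"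
      by (subst nn_integral_fst_count_space[symmetric]) simp
    also have "\<dots> = (\<integral>\<^sup>+\<sigma>. F n \<sigma> \<partial>count_space UNIV) * (\<Sum>j. g n j)"
      by (simp add: nn_integral_cmult nn_integral_multc nn_integral_count_space_nat)
    finally show ?case using Suc by simp
  qed
  also have "(\<integral>\<^sup>+\<sigma>. F n \<sigma> \<partial>count_space UNIV) =
      (\<integral>\<^sup>+\<sigma>. (\<Prod>k<n. g k (\<sigma> ! k)) \<partial>count_space {\<sigma>. length \<sigma> = n})"
    by (subst nn_integral_count_space_eq[where B = "{\<sigma>. length \<sigma> = n}"])
       (auto simp: F_def intro!: nn_integral_cong)
  finally show ?thesis .
qed

locale moran_construction = contraction_vectors \<gamma>
  for \<gamma> :: "'n::finite \<Rightarrow> nat \<Rightarrow> real" +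
  fixes J :: "'a::euclidean_space set" and \<omega> :: "nat \<Rightarrow> 'n" and S :: "nat list \<Rightarrow> 'a set"
  assumes J: "compact J" "interior J \<noteq> {}" "diameter J = 1"
    and collection: "moran_collection J \<gamma> \<omega> S"
begin

lemma J_nonempty: "J \<noteq> {}" using J(2) by auto

lemma S_similar: "\<exists>f r. 0 < r \<and> (\<forall>x y. dist (f x) (f y) = r * dist x y) \<and> S \<sigma> = f ` J"
  using collection unfolding moran_collection_def similarity_def by metis

lemma compact_S: "compact (S \<sigma>)"
proof -
  obtain f r where f: "0 < r" "\<And>x y. dist (f x) (f y) = r * dist x y" "S \<sigma> = f ` J"
    using S_similar[of \<sigma>] by metis
  have "continuous_on J f"
    by (rule lipschitz_on_continuous_on[of r]) (use f in \<open>auto intro!: lipschitz_onI\<close>)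
  thus ?thesis unfolding f(3) using J(1) by (rule compact_continuous_image)
qed

lemma S_nonempty: "S \<sigma> \<noteq> {}"
  using J_nonempty by (metis S_similar image_is_empty)

lemma diameter_S_pos: "0 < diameter (S \<sigma>)"
proof -
  obtain f r where f: "0 < r" "\<And>x y. dist (f x) (f y) = r * dist x y" "S \<sigma> = f ` J"
    using S_similar[of \<sigma>] by metis
  thus ?thesis using scaling_map_diameter[OF f(1,2) J(1) J_nonempty] J(3) by simp
qed

text \<open>A ball inside \<open>J\<close> is carried by the similarity to a ball in \<open>S \<sigma>\<close>, scaled by the same factor as the
  diameter.\<close>

lemma S_contains_ball:
  "\<exists>c>0. \<forall>\<sigma>. \<exists>x. ball x (c * diameter (S \<sigma>)) \<subseteq> S \<sigma>"
proof -
  obtain x0 where "x0 \<in> interior J" using J(2) by blast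
  then obtain c where c: "0 < c" "ball x0 c \<subseteq> J" using mem_interior by blast
  have "\<exists>x. ball x (c * diameter (S \<sigma>)) \<subseteq> S \<sigma>" for \<sigma>
  proof -
    obtain f r where f: "0 < r" "\<And>x y. dist (f x) (f y) = r * dist x y" "S \<sigma> = f ` J"
      using S_similar[of \<sigma>] by metis
    have "diameter (S \<sigma>) = r"
      using scaling_map_diameter[OF f(1,2) J(1) J_nonempty] J(3) f(3) by simp
    hence "ball (f x0) (c * diameter (S \<sigma>)) = f ` ball x0 c"
      using scaling_map_image_ball[OF f(1,2)] by (simp add: mult.commute)
    thus ?thesis using c f(3) by (intro exI[of _ "f x0"]) auto
  qed
  with c show ?thesis by blast
qed

lemma diameter_S_snoc: "diameter (S (\<sigma> @ [j])) = \<gamma> (\<omega> (length \<sigma>)) j * diameter (S \<sigma>)"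
proof -
  have "diameter (S (\<sigma> @ [j])) / diameter (S \<sigma>) = \<gamma> (\<omega> (length \<sigma>)) j"
    using collection by (simp add: moran_collection_def)
  thus ?thesis using diameter_S_pos[of \<sigma>] by (simp add: field_simps)
qed

lemma diameter_S: "diameter (S \<sigma>) = (\<Prod>k<length \<sigma>. \<gamma> (\<omega> k) (\<sigma> ! k))"
proof (induction \<sigma> rule: rev_induct)
  case Nil
  show ?case using collection J(3) by (simp add: moran_collection_def)
next
  case (snoc j \<sigma>)
  have "(\<Prod>k<length \<sigma>. \<gamma> (\<omega> k) ((\<sigma> @ [j]) ! k)) = (\<Prod>k<length \<sigma>. \<gamma> (\<omega> k) (\<sigma> ! k))"
    by (rule prod.cong) (auto simp: nth_append)
  thus ?case using snoc by (simp add: diameter_S_snoc mult.commute)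
qed

lemma diameter_S_le:
  assumes "\<And>i j. \<gamma> i j \<le> c"
  shows "diameter (S \<sigma>) \<le> c ^ length \<sigma>"
proof -
  have "(\<Prod>k<length \<sigma>. \<gamma> (\<omega> k) (\<sigma> ! k)) \<le> (\<Prod>k<length \<sigma>. c)"
    using assms less_imp_le[OF pos] by (intro prod_mono) auto
  thus ?thesis by (simp add: diameter_S)
qed

lemma S_append: "S (\<sigma> @ \<tau>) \<subseteq> S \<sigma>"
proof (induction \<tau> rule: rev_induct)
  case (snoc j \<tau>)
  have "S ((\<sigma> @ \<tau>) @ [j]) \<subseteq> S (\<sigma> @ \<tau>)" using collection unfolding moran_collection_def by blast
  thus ?case using snoc by simp
qed simp

text \<open>At the first position where two incomparable words differ they descend to different children of one set.\<close>

lemma S_parallel_disjoint: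
  assumes "\<sigma> \<parallel> \<tau>"
  shows "interior (S \<sigma>) \<inter> interior (S \<tau>) = {}"
proof -
  obtain p i \<sigma>' j \<tau>' where d: "i \<noteq> j" "\<sigma> = p @ i # \<sigma>'" "\<tau> = p @ j # \<tau>'"
    using parallel_decomp[OF assms] by blast
  have "interior (S \<sigma>) \<subseteq> interior (S (p @ [i]))" "interior (S \<tau>) \<subseteq> interior (S (p @ [j]))"
    using S_append[of "p @ [i]" \<sigma>'] S_append[of "p @ [j]" \<tau>'] d by (auto intro!: interior_mono)
  moreover have "interior (S (p @ [i])) \<inter> interior (S (p @ [j])) = {}"
    using collection d(1) unfolding moran_collection_def by blast
  ultimately show ?thesis by blast
qed

lemma moran_fractal_subset_level: "0 < n \<Longrightarrow> moran_fractal S \<subseteq> (\<Union>\<sigma>\<in>{\<sigma>. length \<sigma> = n}. S \<sigma>)"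
proof
  fix x assume "0 < n" "x \<in> moran_fractal S"
  then obtain \<tau> where "\<forall>k\<in>{1..}. x \<in> S (map \<tau> [0..<k])" unfolding moran_fractal_def by blast
  hence "x \<in> S (map \<tau> [0..<n])" using \<open>0 < n\<close> by (simp add: Suc_le_eq)
  thus "x \<in> (\<Union>\<sigma>\<in>{\<sigma>. length \<sigma> = n}. S \<sigma>)"
    by (intro UN_I[of "map \<tau> [0..<n]"]) auto
qed

lemma log_average_tendsto:
  assumes "has_frequencies \<omega> \<eta>"
  shows "(\<lambda>n. (\<Sum>k<n. log_sum t $ \<omega> k) / real n) \<longlonglongrightarrow> pressure \<gamma> \<eta> t"
  using digit_average_tendsto[OF assms, of "\<lambda>i. log_sum t $ i"]
  by (simp add: pressure_eq_inner inner_vec_def)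

text \<open>All words of a level use the same contraction vector at each position, so the sum over words factors.\<close>

lemma level_sum:
  assumes "\<theta> < t"
  shows "(\<integral>\<^sup>+\<sigma>. ennreal (diameter (S \<sigma>) powr t) \<partial>count_space {\<sigma>. length \<sigma> = n}) =
     ennreal (exp (\<Sum>k<n. log_sum t $ \<omega> k))"
proof -
  have "(\<integral>\<^sup>+\<sigma>. ennreal (diameter (S \<sigma>) powr t) \<partial>count_space {\<sigma>. length \<sigma> = n}) =
      (\<integral>\<^sup>+\<sigma>. (\<Prod>k<n. ennreal (\<gamma> (\<omega> k) (\<sigma> ! k) powr t)) \<partial>count_space {\<sigma>. length \<sigma> = n})"
    by (rule nn_integral_cong) (auto simp: diameter_S prod_ennreal prod_powr_distrib less_imp_le[OF pos])
  also have "\<dots> = (\<Prod>k<n. \<Sum>j. ennreal (\<gamma> (\<omega> k) j powr t))" by (rule nn_integral_words_prod)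
  also have "\<dots> = (\<Prod>k<n. ennreal (power_sum (\<omega> k) t))"
    unfolding power_sum_def using assms by (intro prod.cong suminf_ennreal2 powr_summable) auto
  also have "\<dots> = ennreal (\<Prod>k<n. power_sum (\<omega> k) t)"
    using assms by (intro prod_ennreal less_imp_le power_sum_pos)
  also have "(\<Prod>k<n. power_sum (\<omega> k) t) = (\<Prod>k<n. exp (log_sum t $ \<omega> k))"
    using power_sum_pos[OF assms] by (intro prod.cong) (auto simp: log_sum_def)
  also have "\<dots> = exp (\<Sum>k<n. log_sum t $ \<omega> k)" by (simp add: exp_sum)
  finally show ?thesis .
qed

text \<open>The pieces of level \<open>n\<close> form a cover whose \<open>t\<close>-th powers of diameters add up to
  \<open>exp (n (P + o(1)))\<close> with \<open>P < 0\<close>.\<close>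

lemma hausdorff_measure_zero_if_pressure_neg:
  assumes freq: "has_frequencies \<omega> \<eta>" and t: "\<theta> < t" "pressure \<gamma> \<eta> t < 0"
  shows "hausdorff_measure t (moran_fractal S) = 0"
  unfolding hausdorff_measure_eq_0_iff
proof (intro allI impI)
  fix \<delta> :: real assume "0 < \<delta>"
  obtain c where c: "0 < c" "c < 1" "\<And>i j. \<gamma> i j \<le> c" using contraction_bound by metis
  have "filterlim (\<lambda>n. (\<Sum>k<n. log_sum t $ \<omega> k) / real n * real n) at_bot sequentially"
    by (rule filterlim_tendsto_neg_mult_at_bot[OF log_average_tendsto[OF freq] t(2) filterlim_real_sequentially])
  also have "(\<lambda>n. (\<Sum>k<n. log_sum t $ \<omega> k) / real n * real n) = (\<lambda>n. \<Sum>k<n. log_sum t $ \<omega> k)"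
    by (rule ext) (auto simp: field_simps)
  finally have lim: "(\<lambda>n. ennreal (exp (\<Sum>k<n. log_sum t $ \<omega> k))) \<longlonglongrightarrow> ennreal 0"
    by (intro tendsto_ennrealI filterlim_compose[OF exp_at_bot])
  have "(\<lambda>n. c ^ n) \<longlonglongrightarrow> 0" using c by (intro LIMSEQ_realpow_zero) auto
  hence "eventually (\<lambda>n. c ^ n < \<delta>) sequentially" using \<open>0 < \<delta>\<close> by (rule order_tendstoD)
  hence "eventually (\<lambda>n. hausdorff_premeasure t \<delta> (moran_fractal S) \<le>
      ennreal (exp (\<Sum>k<n. log_sum t $ \<omega> k))) sequentially"
    using eventually_gt_at_top[of 0]
  proof eventually_elim
    case (elim n)
    have "bij_betw (\<lambda>j. replicate n j) UNIV (range (replicate n :: nat \<Rightarrow> nat list))"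
      using elim by (intro inj_on_imp_bij_betw) (auto simp: inj_def)
    hence "infinite (range (replicate n :: nat \<Rightarrow> nat list))"
      by (metis bij_betw_finite infinite_UNIV_nat)
    hence inf: "infinite {\<sigma> :: nat list. length \<sigma> = n}"
      by (rule infinite_super[rotated]) auto
    have "hausdorff_premeasure t \<delta> (moran_fractal S) \<le>
        (\<integral>\<^sup>+\<sigma>. ennreal (diameter (S \<sigma>) powr t) \<partial>count_space {\<sigma>. length \<sigma> = n})"
    proof (rule hausdorff_premeasure_le_countable_cover[OF _ inf])
      show "moran_fractal S \<subseteq> (\<Union>\<sigma>\<in>{\<sigma>. length \<sigma> = n}. S \<sigma>)"
        by (rule moran_fractal_subset_level) (use elim in simp)
      show "bounded (S \<sigma>) \<and> diameter (S \<sigma>) \<le> \<delta>" if "\<sigma> \<in> {\<sigma>. length \<sigma> = n}" for \<sigma>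
        using diameter_S_le[OF c(3), of \<sigma>] that elim compact_imp_bounded[OF compact_S] by auto
    qed auto
    thus ?case by (simp add: level_sum[OF t(1)])
  qed
  hence "hausdorff_premeasure t \<delta> (moran_fractal S) \<le> ennreal 0"
    by (intro tendsto_lowerbound[OF lim]) auto
  thus "hausdorff_premeasure t \<delta> (moran_fractal S) = 0" by simp
qed

end

section \<open>A measure on the coding space bounding the dimension from below\<close>

context moran_construction
begin

text \<open>The nested pieces along \<open>\<tau>\<close> shrink to a single point, the one coded by \<open>\<tau>\<close>.\<close>

definition coding_point :: "(nat \<Rightarrow> nat) \<Rightarrow> 'a" where
  "coding_point \<tau> = (SOME x. \<forall>k. x \<in> S (map \<tau> [0..<k]))"

lemma coding_point_mem: "coding_point \<tau> \<in> S (map \<tau> [0..<k])"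
proof -
  have "\<Inter>(range (\<lambda>k. S (map \<tau> [0..<k]))) \<noteq> {}"
  proof (rule compact_nest)
    fix m n :: nat assume "m \<le> n"
    hence "map \<tau> [0..<n] = map \<tau> [0..<m] @ map \<tau> [m..<n]"
      by (metis map_append upt_add_eq_append le_add_diff_inverse zero_le)
    thus "S (map \<tau> [0..<n]) \<subseteq> S (map \<tau> [0..<m])" by (simp add: S_append)
  qed (auto simp: compact_S S_nonempty)
  hence "\<exists>x. \<forall>k. x \<in> S (map \<tau> [0..<k])" by auto
  thus ?thesis unfolding coding_point_def by (rule someI2_ex) auto
qed

lemma coding_point_in_fractal: "coding_point \<tau> \<in> moran_fractal S"
  using coding_point_mem by (auto simp: moran_fractal_def)

lemma diameter_S_prefix_tendsto_0:
  assumes "0 < \<rho>"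
  shows "\<exists>n. diameter (S (map \<tau> [0..<n])) \<le> \<rho>"
proof -
  obtain c where c: "0 < c" "c < 1" "\<And>i j. \<gamma> i j \<le> c" using contraction_bound by metis
  obtain n where "c ^ n < \<rho>" using real_arch_pow_inv[OF assms c(2)] by blast
  hence "diameter (S (map \<tau> [0..<n])) \<le> \<rho>"
    using diameter_S_le[OF c(3), of "map \<tau> [0..<n]"] by simp
  thus ?thesis ..
qed

text \<open>Along each sequence the construction is stopped as soon as the pieces have diameter at most \<open>\<rho>\<close>.  The
  stopped pieces have nearly equal size, unlike the pieces of a fixed level.\<close>

definition stopping_time :: "real \<Rightarrow> (nat \<Rightarrow> nat) \<Rightarrow> nat" where
  "stopping_time \<rho> \<tau> = (LEAST n. diameter (S (map \<tau> [0..<n])) \<le> \<rho>)"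

definition stopping_word :: "real \<Rightarrow> (nat \<Rightarrow> nat) \<Rightarrow> nat list" where
  "stopping_word \<rho> \<tau> = map \<tau> [0..<stopping_time \<rho> \<tau>]"

text \<open>The stopped pieces seen from \<open>U\<close> when only the first \<open>N\<close> branches are allowed.\<close>

definition stopping_words :: "nat \<Rightarrow> real \<Rightarrow> 'a set \<Rightarrow> nat list set" where
  "stopping_words N \<rho> U = stopping_word \<rho> ` {\<tau>. (\<forall>k. \<tau> k < N) \<and> coding_point \<tau> \<in> U}"

lemma diameter_stopping_word_le: "0 < \<rho> \<Longrightarrow> diameter (S (stopping_word \<rho> \<tau>)) \<le> \<rho>"
  unfolding stopping_word_def stopping_time_def
  by (rule LeastI_ex) (rule diameter_S_prefix_tendsto_0)

text \<open>One step before stopping the diameter still exceeds \<open>\<rho>\<close>, and the last step shrinks it at most by \<open>m\<close>.\<close>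

lemma diameter_stopping_word_ge:
  assumes "0 < \<rho>" "\<rho> < 1" and m: "\<And>k. m \<le> \<gamma> (\<omega> k) (\<tau> k)"
  shows "m * \<rho> \<le> diameter (S (stopping_word \<rho> \<tau>))"
proof -
  let ?n = "stopping_time \<rho> \<tau>"
  have "?n \<noteq> 0"
  proof
    assume "?n = 0"
    hence "diameter (S []) \<le> \<rho>"
      using diameter_stopping_word_le[of \<rho> \<tau>] assms by (simp add: stopping_word_def)
    thus False using \<open>\<rho> < 1\<close> by (simp add: diameter_S)
  qed
  then obtain k where k: "?n = Suc k" using not0_implies_Suc by blast
  have "\<rho> < diameter (S (map \<tau> [0..<k]))"
    using not_less_Least[of k "\<lambda>n. diameter (S (map \<tau> [0..<n])) \<le> \<rho>"] k
    by (simp add: stopping_time_def not_le)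
  hence "m * \<rho> \<le> \<gamma> (\<omega> k) (\<tau> k) * diameter (S (map \<tau> [0..<k]))"
    using m[of k] assms pos[of "\<omega> k" "\<tau> k"] by (intro mult_mono) (auto simp: less_imp_le)
  also have "\<dots> = diameter (S (stopping_word \<rho> \<tau>))"
    using diameter_S_snoc[of "map \<tau> [0..<k]" "\<tau> k"] by (simp add: stopping_word_def k)
  finally show ?thesis .
qed

text \<open>A sequence passing through a stopped piece must itself stop there at the latest, so no stopping word is a
  proper prefix of another.\<close>

lemma stopping_words_parallel:
  assumes "0 < \<rho>" "stopping_word \<rho> \<tau> \<noteq> stopping_word \<rho> \<tau>'"
  shows "stopping_word \<rho> \<tau> \<parallel> stopping_word \<rho> \<tau>'"
proof -
  have *: "stopping_word \<rho> \<tau> = stopping_word \<rho> \<tau>'"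
    if pre: "prefix (stopping_word \<rho> \<tau>) (stopping_word \<rho> \<tau>')" for \<tau> \<tau>'
  proof -
    let ?n = "stopping_time \<rho> \<tau>" and ?n' = "stopping_time \<rho> \<tau>'"
    have le: "?n \<le> ?n'" using prefix_length_le[OF pre] by (simp add: stopping_word_def)
    obtain zs where "stopping_word \<rho> \<tau>' = stopping_word \<rho> \<tau> @ zs" using pre by (auto simp: prefix_def)
    hence "stopping_word \<rho> \<tau> = take ?n (stopping_word \<rho> \<tau>')" by (simp add: stopping_word_def)
    also have "\<dots> = map \<tau>' [0..<?n]" using le by (simp add: stopping_word_def take_map take_upt)
    finally have eq: "stopping_word \<rho> \<tau> = map \<tau>' [0..<?n]" .
    hence "diameter (S (map \<tau>' [0..<?n])) \<le> \<rho>"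
      using diameter_stopping_word_le[OF assms(1), of \<tau>] by simp
    hence "?n' \<le> ?n" unfolding stopping_time_def[of \<rho> \<tau>'] by (rule Least_le)
    with le eq show ?thesis by (simp add: stopping_word_def)
  qed
  show ?thesis using *[of \<tau> \<tau>'] *[of \<tau>' \<tau>] assms(2) by (auto simp: parallel_def)
qed

text \<open>The stopped pieces meeting \<open>U\<close> contain disjoint balls of radius comparable to \<open>\<rho>\<close> and lie within
  distance \<open>2 \<rho>\<close> of a point of \<open>U\<close>; hence their number is bounded, uniformly in \<open>U\<close> and \<open>\<rho>\<close>.  The
  restriction to \<open>N\<close> branches provides a positive lower bound for the ratios.\<close>

lemma stopping_words_card_bound:
  "\<exists>C>0. \<forall>U \<rho>. bounded U \<longrightarrow> diameter U \<le> \<rho> \<longrightarrow> 0 < \<rho> \<longrightarrow> \<rho> < 1 \<longrightarrow>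
     finite (stopping_words N \<rho> U) \<and>
     real (card (stopping_words N \<rho> U)) \<le> C"
proof -
  define m where "m = Min (insert 1 ((\<lambda>(i, j). \<gamma> i j) ` (UNIV \<times> {..<N})))"
  have m_pos: "0 < m" unfolding m_def by (subst Min_gr_iff) (auto simp: pos)
  have m_le: "m \<le> \<gamma> i j" if "j < N" for i j
    unfolding m_def by (rule Min_le) (use that in auto)
  obtain c where c: "0 < c" "\<And>\<sigma>. \<exists>x. ball x (c * diameter (S \<sigma>)) \<subseteq> S \<sigma>"
    using S_contains_ball by metis
  then obtain z where z: "\<And>\<sigma>. ball (z \<sigma>) (c * diameter (S \<sigma>)) \<subseteq> S \<sigma>" by metis
  define C where "C = (2 / (c * m)) ^ DIM('a)"
  have C: "0 < C" using c m_pos by (simp add: C_def)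
  have "finite (stopping_words N \<rho> U) \<and>
     real (card (stopping_words N \<rho> U)) \<le> C"
    if U: "bounded U" "diameter U \<le> \<rho>" and \<rho>: "0 < \<rho>" "\<rho> < 1" for U \<rho>
  proof -
    let ?X = "{\<tau>. (\<forall>k. \<tau> k < N) \<and> coding_point \<tau> \<in> U}"
    let ?W = "stopping_words N \<rho> U"
    have bound: "real (card G) \<le> C" if W: "G \<subseteq> ?W" "finite G" for G
    proof (cases "G = {}")
      case True
      thus ?thesis using C by simp
    next
      case False
      have G: "G \<subseteq> stopping_word \<rho> ` ?X" using W(1) by (simp add: stopping_words_def)
      with False obtain u where u: "u \<in> U" by blast
      have ball: "ball (z \<sigma>) (c * (m * \<rho>)) \<subseteq> S \<sigma>" if "\<sigma> \<in> G" for \<sigma>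
      proof -
        from that G obtain \<tau> where \<tau>: "\<tau> \<in> ?X" "\<sigma> = stopping_word \<rho> \<tau>" by blast
        have "m * \<rho> \<le> diameter (S \<sigma>)"
          unfolding \<tau>(2) by (rule diameter_stopping_word_ge) (use \<rho> \<tau>(1) m_le in auto)
        hence "ball (z \<sigma>) (c * (m * \<rho>)) \<subseteq> ball (z \<sigma>) (c * diameter (S \<sigma>))"
          using c(1) by (intro subset_ball) simp
        thus ?thesis using z by blast
      qed
      have "real (card G) \<le> (2 * \<rho> / (c * (m * \<rho>))) ^ DIM('a)"
      proof (rule disjoint_balls_card_le[where x = z and u = u])
        show "disjoint_family_on (\<lambda>\<sigma>. ball (z \<sigma>) (c * (m * \<rho>))) G"
          unfolding disjoint_family_on_def
        proof (intro ballI impI)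
          fix \<sigma> \<sigma>' assume \<sigma>: "\<sigma> \<in> G" "\<sigma>' \<in> G" "\<sigma> \<noteq> \<sigma>'"
          have "\<sigma> \<parallel> \<sigma>'" using \<sigma> G stopping_words_parallel[OF \<rho>(1)] by blast
          moreover have "ball (z \<sigma>) (c * (m * \<rho>)) \<subseteq> interior (S \<sigma>)"
            "ball (z \<sigma>') (c * (m * \<rho>)) \<subseteq> interior (S \<sigma>')"
            using ball[OF \<sigma>(1)] ball[OF \<sigma>(2)] by (simp_all add: interior_maximal)
          ultimately show "ball (z \<sigma>) (c * (m * \<rho>)) \<inter> ball (z \<sigma>') (c * (m * \<rho>)) = {}"
            using S_parallel_disjoint[of \<sigma> \<sigma>'] by blast
        qed
        show "ball (z \<sigma>) (c * (m * \<rho>)) \<subseteq> cball u (2 * \<rho>)" if \<sigma>: "\<sigma> \<in> G" for \<sigma>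
        proof
          fix y assume "y \<in> ball (z \<sigma>) (c * (m * \<rho>))"
          hence y: "y \<in> S \<sigma>" using ball[OF \<sigma>] by blast
          from \<sigma> G obtain \<tau> where \<tau>: "\<tau> \<in> ?X" "\<sigma> = stopping_word \<rho> \<tau>" by blast
          have "coding_point \<tau> \<in> S \<sigma>"
            unfolding \<tau>(2) stopping_word_def by (rule coding_point_mem)
          hence "dist (coding_point \<tau>) y \<le> \<rho>"
            using diameter_bounded_bound[OF compact_imp_bounded[OF compact_S] _ y]
              diameter_stopping_word_le[OF \<rho>(1), of \<tau>] \<tau>(2) by fastforce
          moreover have "dist u (coding_point \<tau>) \<le> \<rho>"
            using diameter_bounded_bound[OF U(1) u, of "coding_point \<tau>"] \<tau>(1) U(2) by auto
          ultimately show "y \<in> cball u (2 * \<rho>)"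
            using dist_triangle[of u y "coding_point \<tau>"] by simp
        qed
      qed (use W(2) \<rho> c m_pos in auto)
      also have "2 * \<rho> / (c * (m * \<rho>)) = 2 / (c * m)" using \<rho> by simp
      finally show ?thesis by (simp add: C_def)
    qed
    have "finite ?W \<and> card ?W \<le> nat \<lfloor>C\<rfloor>"
      by (rule finite_if_finite_subsets_card_bdd) (use bound C in \<open>auto simp: le_nat_floor\<close>)
    thus ?thesis using bound by blast
  qed
  with C show ?thesis by blast
qed

text \<open>The truncated sums converge to the full ones, and the pressure is a continuous function of these finitely
  many sums.\<close>

lemma truncated_pressure_pos:
  assumes t: "\<theta> < t" "0 < pressure \<gamma> \<eta> t"
  shows "\<exists>N>0. 0 < (\<Sum>i\<in>UNIV. \<eta> $ i * ln (\<Sum>j<N. \<gamma> i j powr t))"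
proof -
  have "(\<lambda>N. \<Sum>i\<in>UNIV. \<eta> $ i * ln (\<Sum>j<N. \<gamma> i j powr t)) \<longlonglongrightarrow>
      (\<Sum>i\<in>UNIV. \<eta> $ i * ln (power_sum i t))"
  proof (intro tendsto_sum tendsto_mult tendsto_const tendsto_ln)
    show "(\<lambda>N. \<Sum>j<N. \<gamma> i j powr t) \<longlonglongrightarrow> power_sum i t" for i
      unfolding power_sum_def by (rule summable_LIMSEQ[OF powr_summable[OF t(1)]])
    show "power_sum i t \<noteq> 0" for i using power_sum_pos[OF t(1), of i] by simp
  qed
  hence "eventually (\<lambda>N. 0 < (\<Sum>i\<in>UNIV. \<eta> $ i * ln (\<Sum>j<N. \<gamma> i j powr t))) sequentially"
    using t(2) by (intro order_tendstoD(1)) (auto simp: pressure_def power_sum_def)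
  hence "eventually (\<lambda>N. 0 < N \<and> 0 < (\<Sum>i\<in>UNIV. \<eta> $ i * ln (\<Sum>j<N. \<gamma> i j powr t))) sequentially"
    by (intro eventually_conj eventually_gt_at_top)
  thus ?thesis by (rule eventually_happens'[OF sequentially_bot])
qed

text \<open>The measure is the product over \<open>k\<close> of the distributions on \<open>{..<N}\<close> with weights proportional to
  \<open>\<gamma> (\<omega> k) j powr t\<close>.  The cylinder of \<open>\<sigma>\<close> has mass \<open>diameter (S \<sigma>) powr t\<close> divided by the product of the
  normalising constants, and positivity of the truncated pressure makes these products grow exponentially.\<close>

lemma cylinder_measure_exists:
  assumes freq: "has_frequencies \<omega> \<eta>" and t: "\<theta> < t" "0 < pressure \<gamma> \<eta> t"
  shows "\<exists>N K (M :: (nat \<Rightarrow> nat) measure). 0 < K \<and> prob_space M \<and>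
    (\<forall>\<tau>\<in>space M. \<forall>k. \<tau> k < N) \<and>
    (\<forall>\<sigma>. \<exists>A\<in>sets M. {\<tau>\<in>space M. map \<tau> [0..<length \<sigma>] = \<sigma>} \<subseteq> A \<and>
        emeasure M A \<le> ennreal (K * diameter (S \<sigma>) powr t))"
proof -
  obtain N where N: "0 < N" "0 < (\<Sum>i\<in>UNIV. \<eta> $ i * ln (\<Sum>j<N. \<gamma> i j powr t))"
    using truncated_pressure_pos[OF t] by blast
  define B where "B i = (\<Sum>j<N. \<gamma> i j powr t)" for i
  have B: "0 < B i" for i unfolding B_def using N(1) by (intro sum_pos) (auto simp: ratio_nonzero)
  define Z where "Z n = (\<Prod>k<n. B (\<omega> k))" for n
  have Z_pos: "0 < Z n" for n unfolding Z_def using B by (intro prod_pos) auto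
  \<comment> \<open>The normalising products tend to infinity, so their inverses are bounded by some \<open>K\<close>.\<close>
  have "filterlim (\<lambda>n. (\<Sum>k<n. ln (B (\<omega> k))) / real n * real n) at_top sequentially"
    by (rule filterlim_tendsto_pos_mult_at_top[OF digit_average_tendsto[OF freq, of "\<lambda>i. ln (B i)"] _ filterlim_real_sequentially])
       (use N(2) in \<open>simp add: B_def\<close>)
  also have "(\<lambda>n. (\<Sum>k<n. ln (B (\<omega> k))) / real n * real n) = (\<lambda>n. ln (Z n))"
  proof
    fix n
    have "ln (Z n) = (\<Sum>k<n. ln (B (\<omega> k)))"
      unfolding Z_def by (intro ln_prod) (auto simp: less_imp_neq[OF B, symmetric])
    thus "(\<Sum>k<n. ln (B (\<omega> k))) / real n * real n = ln (Z n)" by (cases "n = 0") auto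
  qed
  finally have "filterlim (\<lambda>n. exp (ln (Z n))) at_top sequentially"
    by (rule filterlim_compose[OF exp_at_top])
  hence "filterlim Z at_top sequentially" using Z_pos by simp
  hence "(\<lambda>n. inverse (Z n)) \<longlonglongrightarrow> 0" by (rule tendsto_inverse_0_at_top)
  hence "Bseq (\<lambda>n. inverse (Z n))" by (rule convergent_imp_Bseq[OF convergentI])
  then obtain K where K: "0 < K" "\<And>n. norm (inverse (Z n)) \<le> K" by (auto elim: BseqE)
  define Q where "Q k = point_measure {..<N} (\<lambda>j. ennreal (\<gamma> (\<omega> k) j powr t / B (\<omega> k)))" for k
  have space_Q: "space (Q k) = {..<N}" and sets_Q: "sets (Q k) = Pow {..<N}" for k
    by (simp_all add: Q_def space_point_measure sets_point_measure)
  have emeasure_Q: "emeasure (Q k) {j} = ennreal (\<gamma> (\<omega> k) j powr t / B (\<omega> k))" if "j < N" for k j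
    unfolding Q_def using that by (subst emeasure_point_measure_finite) auto
  have "emeasure (Q k) {..<N} = 1" for k
  proof -
    have "emeasure (Q k) {..<N} = ennreal (\<Sum>j<N. \<gamma> (\<omega> k) j powr t / B (\<omega> k))"
      unfolding Q_def using B[of "\<omega> k"] by (subst emeasure_point_measure_finite) auto
    also have "(\<Sum>j<N. \<gamma> (\<omega> k) j powr t / B (\<omega> k)) = 1"
      using B[of "\<omega> k"] by (simp add: B_def flip: sum_divide_distrib)
    finally show ?thesis by simp
  qed
  hence prob_Q: "prob_space (Q k)" for k by (intro prob_spaceI) (simp add: space_Q)
  interpret product_prob_space Q UNIV by (intro product_prob_spaceI prob_Q)
  define M where "M = Pi\<^sub>M UNIV Q"
  have space_M: "\<tau> k < N" if "\<tau> \<in> space M" for \<tau> k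
    using that by (auto simp: M_def space_PiM space_Q PiE_iff)
  have nth_of_prefix: "\<tau> k = \<sigma> ! k" if "map \<tau> [0..<length \<sigma>] = \<sigma>" "k < length \<sigma>"
    for \<tau> \<sigma> and k :: nat
    using arg_cong[OF that(1), of "\<lambda>w. w ! k"] that(2) by simp
  have "\<exists>A\<in>sets M. {\<tau>\<in>space M. map \<tau> [0..<length \<sigma>] = \<sigma>} \<subseteq> A \<and>
        emeasure M A \<le> ennreal (K * diameter (S \<sigma>) powr t)" for \<sigma>
    \<comment> \<open>A word using a branch outside \<open>{..<N}\<close> has an empty cylinder.\<close>
  proof (cases "\<forall>k<length \<sigma>. \<sigma> ! k < N")
    case True
    let ?n = "length \<sigma>"
    let ?A = "{\<tau>\<in>space M. \<forall>k\<in>{..<?n}. \<tau> k \<in> {\<sigma> ! k}}"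
    have "?A = prod_emb UNIV Q {..<?n} (\<Pi>\<^sub>E k\<in>{..<?n}. {\<sigma> ! k})"
      using True by (auto simp: prod_emb_def M_def space_PiM PiE_iff space_Q)
    moreover have "\<dots> \<in> sets M"
      unfolding M_def using True by (intro sets_PiM_I) (auto simp: sets_Q)
    ultimately have meas: "?A \<in> sets M" by simp
    have "emeasure M ?A = (\<Prod>k<?n. emeasure (Q k) {\<sigma> ! k})"
      unfolding M_def using True by (intro emeasure_PiM_Collect) (auto simp: sets_Q)
    also have "\<dots> = (\<Prod>k<?n. ennreal (\<gamma> (\<omega> k) (\<sigma> ! k) powr t / B (\<omega> k)))"
      using True by (intro prod.cong) (auto simp: emeasure_Q)
    also have "\<dots> = ennreal (\<Prod>k<?n. \<gamma> (\<omega> k) (\<sigma> ! k) powr t / B (\<omega> k))"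
      using B by (intro prod_ennreal) (auto simp: less_imp_le)
    also have "(\<Prod>k<?n. \<gamma> (\<omega> k) (\<sigma> ! k) powr t / B (\<omega> k)) = diameter (S \<sigma>) powr t * inverse (Z ?n)"
      by (simp add: diameter_S Z_def prod.distrib prod_powr_distrib less_imp_le[OF pos]
            divide_inverse flip: prod_inversef)
    also have "\<dots> \<le> diameter (S \<sigma>) powr t * K"
      using K(2)[of ?n] Z_pos[of ?n] by (intro mult_left_mono) auto
    finally have "emeasure M ?A \<le> ennreal (K * diameter (S \<sigma>) powr t)"
      by (simp add: mult.commute ennreal_leI)
    moreover have "{\<tau>\<in>space M. map \<tau> [0..<?n] = \<sigma>} \<subseteq> ?A"
      using nth_of_prefix by blast
    ultimately show ?thesis using meas by blast
  next
    case False
    then obtain k where k: "k < length \<sigma>" "\<not> \<sigma> ! k < N" by blast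
    have "{\<tau>\<in>space M. map \<tau> [0..<length \<sigma>] = \<sigma>} = {}"
    proof (intro equals0I)
      fix \<tau> assume "\<tau> \<in> {\<tau>\<in>space M. map \<tau> [0..<length \<sigma>] = \<sigma>}"
      hence "\<tau> k < N" "\<tau> k = \<sigma> ! k" using space_M nth_of_prefix k(1) by blast+
      with k(2) show False by simp
    qed
    thus ?thesis by (intro bexI[of _ "{}"]) auto
  qed
  moreover have "prob_space M" unfolding M_def by (rule P.prob_space_axioms)
  ultimately show ?thesis using K(1) space_M by blast
qed

text \<open>A set of diameter \<open>\<rho>\<close> is met by boundedly many stopped pieces, each of mass at most \<open>K * \<rho> powr t\<close>.\<close>

lemma hausdorff_measure_nonzero_if_pressure_pos:
  assumes freq: "has_frequencies \<omega> \<eta>" and t: "\<theta> < t" "0 < pressure \<gamma> \<eta> t"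
  shows "hausdorff_measure t (moran_fractal S) \<noteq> 0"
proof -
  obtain N K and M :: "(nat \<Rightarrow> nat) measure" where M: "0 < K \<and> prob_space M \<and>
    (\<forall>\<tau>\<in>space M. \<forall>k. \<tau> k < N) \<and>
    (\<forall>\<sigma>. \<exists>A\<in>sets M. {\<tau>\<in>space M. map \<tau> [0..<length \<sigma>] = \<sigma>} \<subseteq> A \<and>
        emeasure M A \<le> ennreal (K * diameter (S \<sigma>) powr t))"
    using cylinder_measure_exists[OF assms] by blast
  hence K: "0 < K" and prob: "prob_space M" and bdd: "\<And>\<tau> k. \<tau> \<in> space M \<Longrightarrow> \<tau> k < N" by simp_all
  from M have "\<forall>\<sigma>. \<exists>A. A \<in> sets M \<and> {\<tau>\<in>space M. map \<tau> [0..<length \<sigma>] = \<sigma>} \<subseteq> A \<and>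
        emeasure M A \<le> ennreal (K * diameter (S \<sigma>) powr t)" by blast
  then obtain A where A: "\<And>\<sigma>. A \<sigma> \<in> sets M"
      "\<And>\<sigma>. {\<tau>\<in>space M. map \<tau> [0..<length \<sigma>] = \<sigma>} \<subseteq> A \<sigma>"
      "\<And>\<sigma>. emeasure M (A \<sigma>) \<le> ennreal (K * diameter (S \<sigma>) powr t)"
    by (auto dest!: choice)
  obtain C where "0 < C" and C: "\<forall>U \<rho>. bounded U \<longrightarrow> diameter U \<le> \<rho> \<longrightarrow> 0 < \<rho> \<longrightarrow> \<rho> < 1 \<longrightarrow>
     finite (stopping_words N \<rho> U) \<and> real (card (stopping_words N \<rho> U)) \<le> C"
    using stopping_words_card_bound[of N] by blast
  have scale: "\<exists>D\<in>sets M. coding_point -` U \<inter> space M \<subseteq> D \<and> emeasure M D \<le> ennreal (C * K * \<rho> powr t)"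
    if U: "bounded U" "diameter U \<le> \<rho>" "0 < \<rho>" "\<rho> < 1" for U \<rho>
  proof -
    let ?W = "stopping_words N \<rho> U"
    have W: "finite ?W" "real (card ?W) \<le> C" using C U by auto
    have "coding_point -` U \<inter> space M \<subseteq> (\<Union>\<sigma>\<in>?W. A \<sigma>)"
    proof
      fix \<tau> assume \<tau>: "\<tau> \<in> coding_point -` U \<inter> space M"
      hence "stopping_word \<rho> \<tau> \<in> ?W" using bdd by (auto simp: stopping_words_def)
      moreover have "\<tau> \<in> A (stopping_word \<rho> \<tau>)"
        using A(2)[of "stopping_word \<rho> \<tau>"] \<tau> by (auto simp: stopping_word_def)
      ultimately show "\<tau> \<in> (\<Union>\<sigma>\<in>?W. A \<sigma>)" by blast
    qed
    moreover have "emeasure M (\<Union>\<sigma>\<in>?W. A \<sigma>) \<le> ennreal (C * K * \<rho> powr t)"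
    proof -
      have "emeasure M (\<Union>\<sigma>\<in>?W. A \<sigma>) \<le> (\<Sum>\<sigma>\<in>?W. emeasure M (A \<sigma>))"
        using W(1) A(1) by (intro emeasure_subadditive_finite) auto
      also have "\<dots> \<le> (\<Sum>\<sigma>\<in>?W. ennreal (K * \<rho> powr t))"
      proof (rule sum_mono)
        fix \<sigma> assume "\<sigma> \<in> ?W"
        hence "diameter (S \<sigma>) \<le> \<rho>"
          using diameter_stopping_word_le[OF U(3)] by (auto simp: stopping_words_def)
        hence "K * diameter (S \<sigma>) powr t \<le> K * \<rho> powr t"
          using K diameter_S_pos[of \<sigma>] crit_exponent_nonneg t(1)
          by (intro mult_left_mono powr_mono2) auto
        thus "emeasure M (A \<sigma>) \<le> ennreal (K * \<rho> powr t)"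
          using A(3)[of \<sigma>] by (meson ennreal_leI order_trans)
      qed
      also have "\<dots> = ennreal (real (card ?W) * (K * \<rho> powr t))"
        by (simp add: ennreal_mult' ennreal_of_nat_eq_real_of_nat)
      also have "\<dots> \<le> ennreal (C * (K * \<rho> powr t))"
        using W(2) K by (intro ennreal_leI mult_right_mono) auto
      finally show ?thesis by (simp add: mult.assoc)
    qed
    ultimately show ?thesis
      using W(1) A(1) by (intro bexI[of _ "\<Union>\<sigma>\<in>?W. A \<sigma>"]) auto
  qed
  show ?thesis
  proof (rule mass_distribution_principle[where \<delta> = "1/2" and C = "C * K" and \<pi> = coding_point])
    show "prob_space M" by (fact prob)
    fix U :: "'a set" assume U: "bounded U" "diameter U \<le> 1/2"
    show "\<exists>D\<in>sets M. coding_point -` U \<inter> space M \<subseteq> D \<and>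
        emeasure M D \<le> ennreal (C * K * diameter U powr t)"
    proof (cases "0 < diameter U")
      case True
      thus ?thesis using scale[of U "diameter U"] U by simp
    next
      case False
      \<comment> \<open>A set with at most one point must be enclosed in a null set: use all scales \<open>1 / (n + 2)\<close>.\<close>
      hence diam: "diameter U = 0" using diameter_ge_0[OF U(1)] by simp
      have "\<forall>n. \<exists>D\<in>sets M. coding_point -` U \<inter> space M \<subseteq> D \<and>
          emeasure M D \<le> ennreal (C * K * (1 / real (n + 2)) powr t)"
        using scale[OF U(1)] diam by simp
      then obtain D where D: "\<And>n. D n \<in> sets M" "\<And>n. coding_point -` U \<inter> space M \<subseteq> D n"
          "\<And>n. emeasure M (D n) \<le> ennreal (C * K * (1 / real (n + 2)) powr t)"
        by metis
      have "emeasure M (\<Inter>n. D n) \<le> ennreal (C * K * (1 / real (n + 2)) powr t)" for n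
        using emeasure_mono[of "\<Inter>n. D n" "D n" M] D(1,3) by (meson INF_lower UNIV_I order_trans)
      moreover have "(\<lambda>n. ennreal (C * K * (1 / real (n + 2)) powr t)) \<longlonglongrightarrow> ennreal (C * K * 0 powr t)"
      proof (intro tendsto_ennrealI tendsto_mult tendsto_const tendsto_powr')
        show "(\<lambda>n. 1 / real (n + 2)) \<longlonglongrightarrow> 0"
          using LIMSEQ_ignore_initial_segment[OF lim_const_over_n[of "1::real"], of 2] by simp
      qed (use t(1) crit_exponent_nonneg in auto)
      ultimately have "emeasure M (\<Inter>n. D n) \<le> ennreal (C * K * 0 powr t)"
        by (intro LIMSEQ_le_const) auto
      moreover have "(\<Inter>n. D n) \<in> sets M" using D(1) by auto
      ultimately show ?thesis using D(2) diam by (intro bexI[of _ "\<Inter>n. D n"]) auto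
    qed
  qed (use \<open>0 < C\<close> K coding_point_in_fractal in auto)
qed

lemma hausdorff_dim_eq_pressure_zero:
  assumes \<eta>: "\<eta> \<in> pos_stochastic" "has_frequencies \<omega> \<eta>" and s: "\<theta> < s" "pressure \<gamma> \<eta> s = 0"
  shows "hausdorff_dim (moran_fractal S) = s"
proof (rule hausdorff_dim_eqI[OF crit_exponent_nonneg s(1)])
  fix t assume "s < t"
  thus "hausdorff_measure t (moran_fractal S) = 0"
    using hausdorff_measure_zero_if_pressure_neg[OF \<eta>(2), of t]
      pressure_strict_antimono[OF \<eta>(1) s(1), of t] s by simp
next
  fix t assume "\<theta> < t" "t < s"
  thus "hausdorff_measure t (moran_fractal S) \<noteq> 0"
    using hausdorff_measure_nonzero_if_pressure_pos[OF \<eta>(2), of t]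
      pressure_strict_antimono[OF \<eta>(1), of t s] s by simp
qed

end

section \<open>Affine functions are real-analytic\<close>

text \<open>The expansion at \<open>a\<close> has its constant term at the multi-index \<open>0\<close> and the linear ones at the unit
  multi-indices \<open>e i\<close>; all other coefficients vanish.\<close>

lemma real_analytic_on_affine:
  "real_analytic_on (\<lambda>x :: real^'n::finite. w \<bullet> x + d) N"
  unfolding real_analytic_on_def
proof (intro ballI exI[of _ "1::real"] conjI)
  fix a :: "real^'n" assume "a \<in> N"
  define e :: "'n \<Rightarrow> 'n \<Rightarrow> nat" where "e i = (\<lambda>j. if j = i then 1 else 0)" for i
  define c :: "('n \<Rightarrow> nat) \<Rightarrow> real" where
    "c \<alpha> = (if \<alpha> = (\<lambda>_. 0) then w \<bullet> a + d else if \<alpha> \<in> range e then w $ (SOME i. \<alpha> = e i) else 0)" for \<alpha>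
  have inj: "inj e" by (auto simp: inj_def e_def fun_eq_iff split: if_splits)
  have nz: "e i \<noteq> (\<lambda>_. 0)" for i by (auto simp: e_def fun_eq_iff)
  have c_e: "c (e i) = w $ i" for i
  proof -
    have "(SOME j. e i = e j) = i" using inj by (auto simp: inj_def)
    thus ?thesis using nz by (simp add: c_def)
  qed
  have prod_e: "(\<Prod>j\<in>UNIV. (x $ j - a $ j) ^ e i j) = x $ i - a $ i" for x i
  proof -
    have "(\<Prod>j\<in>UNIV. (x $ j - a $ j) ^ e i j) = (\<Prod>j\<in>UNIV. if j = i then x $ j - a $ j else 1)"
      by (rule prod.cong) (auto simp: e_def)
    thus ?thesis by simp
  qed
  have "((\<lambda>\<alpha>. c \<alpha> * (\<Prod>i\<in>UNIV. (x $ i - a $ i) ^ \<alpha> i)) has_sum (w \<bullet> x + d)) UNIV" for x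
  proof -
    let ?f = "\<lambda>\<alpha>. c \<alpha> * (\<Prod>i\<in>UNIV. (x $ i - a $ i) ^ \<alpha> i)"
    let ?F = "insert (\<lambda>_. 0) (range e)"
    have "sum ?f ?F = ?f (\<lambda>_. 0) + sum ?f (range e)"
      using nz by (subst sum.insert) (auto dest: sym)
    also have "sum ?f (range e) = (\<Sum>i\<in>UNIV. w $ i * (x $ i - a $ i))"
      using inj by (subst sum.reindex) (auto simp: c_e prod_e)
    also have "?f (\<lambda>_. 0) = w \<bullet> a + d" by (simp add: c_def)
    also have "(\<Sum>i\<in>UNIV. w $ i * (x $ i - a $ i)) = w \<bullet> x - w \<bullet> a"
      by (simp add: inner_vec_def right_diff_distrib sum_subtractf)
    finally have "sum ?f ?F = w \<bullet> x + d" by simp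
    hence "(?f has_sum (w \<bullet> x + d)) ?F" by (intro has_sum_finiteI) auto
    thus ?thesis by (rule has_sum_cong_neutral[THEN iffD1, rotated -1]) (auto simp: c_def)
  qed
  thus "\<exists>c. \<forall>x\<in>ball a 1. ((\<lambda>\<alpha>. c \<alpha> * (\<Prod>i\<in>UNIV. (x $ i - a $ i) ^ \<alpha> i)) has_sum w \<bullet> x + d) UNIV"
    by blast
qed simp

section \<open>Zeros of the pressure and the distance to a level set\<close>

lemma pos_stochastic_norm_le: "\<eta> \<in> pos_stochastic \<Longrightarrow> norm \<eta> \<le> 1"
  using norm_le_l1_cart[of \<eta>] by (simp add: pos_stochastic_def less_imp_le)

lemma axis_norm_le: "norm (axis k 1 :: real^'n) \<le> 1"
  by (simp add: norm_axis_1)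

text \<open>The segment from \<open>\<rho>\<close> to the vertex \<open>axis k 1\<close> crosses the hyperplane orthogonal to \<open>v\<close> because the two
  ends lie on opposite sides.  All points of the segment except the vertex have positive entries.\<close>

lemma hyperplane_distance:
  fixes v :: "real^'n"
  assumes \<rho>: "\<rho> \<in> pos_stochastic" and opp: "(\<rho> \<bullet> v) * v $ k < 0"
  shows "\<exists>\<eta>\<in>pos_stochastic. \<eta> \<bullet> v = 0 \<and> dist \<rho> \<eta> \<le> 2 * \<bar>\<rho> \<bullet> v\<bar> / \<bar>v $ k\<bar>"
proof -
  define t where "t = (\<rho> \<bullet> v) / (\<rho> \<bullet> v - v $ k)"
  have t: "0 < t" "t < 1" "t * (\<rho> \<bullet> v - v $ k) = \<rho> \<bullet> v" and t_le: "t \<le> \<bar>\<rho> \<bullet> v\<bar> / \<bar>v $ k\<bar>"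
    using opp by (auto simp: t_def mult_less_0_iff field_simps)
  define \<eta> where "\<eta> = (1 - t) *\<^sub>R \<rho> + t *\<^sub>R axis k 1"
  have "\<eta> \<in> pos_stochastic"
    unfolding pos_stochastic_def
  proof (intro CollectI conjI allI)
    show "0 < \<eta> $ i" for i
      using \<rho> t by (auto simp: \<eta>_def pos_stochastic_def axis_def intro!: add_pos_nonneg)
    have "(\<Sum>i\<in>UNIV. \<eta> $ i) = (1 - t) * (\<Sum>i\<in>UNIV. \<rho> $ i) + t * (\<Sum>i\<in>UNIV. axis k 1 $ i)"
      by (simp add: \<eta>_def sum.distrib sum_distrib_left)
    also have "(\<Sum>i\<in>UNIV. axis k (1::real) $ i) = 1" by (simp add: axis_def)
    finally show "(\<Sum>i\<in>UNIV. \<eta> $ i) = 1" using \<rho> by (simp add: pos_stochastic_def)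
  qed
  moreover have "\<eta> \<bullet> v = 0"
    using t(3) by (simp add: \<eta>_def inner_add_left inner_axis' algebra_simps)
  moreover have "dist \<rho> \<eta> \<le> 2 * \<bar>\<rho> \<bullet> v\<bar> / \<bar>v $ k\<bar>"
  proof -
    have "dist \<rho> \<eta> = norm (t *\<^sub>R (\<rho> - axis k 1))"
      by (simp add: dist_norm \<eta>_def algebra_simps)
    also have "\<dots> = t * norm (\<rho> - axis k 1)" using t by simp
    also have "\<dots> \<le> t * 2"
      using norm_triangle_ineq4[of \<rho> "axis k 1"] pos_stochastic_norm_le[OF \<rho>] axis_norm_le[of k] t
      by (intro mult_left_mono) auto
    also have "\<dots> \<le> (\<bar>\<rho> \<bullet> v\<bar> / \<bar>v $ k\<bar>) * 2" using t_le by (rule mult_right_mono) simp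
    finally show ?thesis by (simp add: mult.commute)
  qed
  ultimately show ?thesis by blast
qed

locale positive_pressure_vectors = contraction_vectors \<gamma>
  for \<gamma> :: "'n::finite \<Rightarrow> nat \<Rightarrow> real" +
  assumes pressure_pos: "\<eta> \<in> pos_stochastic \<Longrightarrow> \<exists>u>\<theta>. 0 < pressure \<gamma> \<eta> u"
begin

text \<open>The zero of Bowen's equation \<open>P\<^sub>\<eta>(s) = 0\<close>.\<close>

definition pressure_root :: "real^'n \<Rightarrow> real" where
  "pressure_root \<eta> = (THE s. \<theta> < s \<and> pressure \<gamma> \<eta> s = 0)"

lemma pressure_root:
  assumes "\<eta> \<in> pos_stochastic"
  shows "\<theta> < pressure_root \<eta>" "pressure \<gamma> \<eta> (pressure_root \<eta>) = 0"
proof -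
  obtain u where "\<theta> < u" "0 < pressure \<gamma> \<eta> u" using pressure_pos[OF assms] by blast
  then obtain s where "\<theta> < s \<and> pressure \<gamma> \<eta> s = 0" using pressure_zero_exists[OF assms] by blast
  hence "\<theta> < pressure_root \<eta> \<and> pressure \<gamma> \<eta> (pressure_root \<eta>) = 0"
    unfolding pressure_root_def by (rule theI) (use pressure_zero_unique[OF assms] \<open>_ \<and> _\<close> in blast)
  thus "\<theta> < pressure_root \<eta>" "pressure \<gamma> \<eta> (pressure_root \<eta>) = 0" by auto
qed

lemma pressure_root_less_iff:
  assumes "\<eta> \<in> pos_stochastic" "\<theta> < c"
  shows "pressure_root \<eta> < c \<longleftrightarrow> pressure \<gamma> \<eta> c < 0"
    and "c < pressure_root \<eta> \<longleftrightarrow> 0 < pressure \<gamma> \<eta> c"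
    and "pressure_root \<eta> = c \<longleftrightarrow> pressure \<gamma> \<eta> c = 0"
  using pressure_root[OF assms(1)] pressure_strict_antimono[OF assms(1) assms(2), of "pressure_root \<eta>"]
    pressure_strict_antimono[OF assms(1), of "pressure_root \<eta>" c]
  by (cases c "pressure_root \<eta>" rule: linorder_cases; simp)+

text \<open>By monotonicity, \<open>c < pressure_root \<eta>\<close> is the open condition \<open>0 < pressure \<gamma> \<eta> c\<close> on \<open>\<eta>\<close>, and
  likewise for the other inequality.\<close>

lemma pressure_root_continuous: "continuous_on pos_stochastic pressure_root"
  unfolding continuous_on_def
proof (intro ballI)
  fix \<eta> :: "real^'n" assume \<eta>: "\<eta> \<in> pos_stochastic"
  let ?F = "at \<eta> within pos_stochastic"
  have mem: "eventually (\<lambda>x. x \<in> pos_stochastic) ?F" by (simp add: eventually_at_filter)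
  have cont: "((\<lambda>x. pressure \<gamma> x c) \<longlongrightarrow> pressure \<gamma> \<eta> c) ?F" for c
    unfolding pressure_eq_inner by (intro tendsto_intros)
  show "(pressure_root \<longlongrightarrow> pressure_root \<eta>) ?F"
  proof (rule order_tendstoI)
    fix c assume c: "c < pressure_root \<eta>"
    show "eventually (\<lambda>x. c < pressure_root x) ?F"
    proof (cases "\<theta> < c")
      case True
      hence "eventually (\<lambda>x. 0 < pressure \<gamma> x c) ?F"
        using c pressure_root_less_iff(2)[OF \<eta> True] by (intro order_tendstoD(1)[OF cont]) simp
      with mem show ?thesis
        by eventually_elim (use True in \<open>simp add: pressure_root_less_iff\<close>)
    next
      case False
      from mem show ?thesis
      proof eventually_elim
        case (elim x)
        thus ?case using pressure_root(1)[of x] False by simp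
      qed
    qed
  next
    fix c assume c: "pressure_root \<eta> < c"
    hence "\<theta> < c" using pressure_root(1)[OF \<eta>] by simp
    hence "eventually (\<lambda>x. pressure \<gamma> x c < 0) ?F"
      using c pressure_root_less_iff(1)[OF \<eta>] by (intro order_tendstoD(2)[OF cont]) simp
    with mem show "eventually (\<lambda>x. pressure_root x < c) ?F"
      by eventually_elim (use \<open>\<theta> < c\<close> in \<open>simp add: pressure_root_less_iff\<close>)
  qed
qed

text \<open>A nonzero vector orthogonal to a vector with positive entries has entries of both signs.\<close>

lemma log_sum_mixed_signs:
  assumes \<eta>: "\<eta> \<in> pos_stochastic" and nz: "log_sum (pressure_root \<eta>) \<noteq> 0"
  shows "\<exists>k. 0 < log_sum (pressure_root \<eta>) $ k" "\<exists>k. log_sum (pressure_root \<eta>) $ k < 0"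
proof -
  let ?v = "log_sum (pressure_root \<eta>)"
  have zero: "(\<Sum>i\<in>UNIV. \<eta> $ i * ?v $ i) = 0"
    using pressure_root(2)[OF \<eta>] by (simp add: pressure_eq_inner inner_vec_def)
  have \<eta>_pos: "0 < \<eta> $ i" for i using \<eta> by (simp add: pos_stochastic_def)
  show "\<exists>k. 0 < ?v $ k"
  proof (rule ccontr)
    assume "\<not> ?thesis"
    hence "\<forall>i\<in>UNIV. 0 \<le> - (\<eta> $ i * ?v $ i)"
      using \<eta>_pos by (auto simp: not_less mult_nonneg_nonpos less_imp_le)
    hence "\<forall>i\<in>UNIV. - (\<eta> $ i * ?v $ i) = 0"
      using zero sum_nonneg_eq_0_iff[of UNIV "\<lambda>i. - (\<eta> $ i * ?v $ i)"] by (simp add: sum_negf)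
    hence "?v = 0" using \<eta>_pos by (simp add: vec_eq_iff less_imp_neq[symmetric, OF \<eta>_pos])
    with nz show False ..
  qed
  show "\<exists>k. ?v $ k < 0"
  proof (rule ccontr)
    assume "\<not> ?thesis"
    hence "\<forall>i\<in>UNIV. 0 \<le> \<eta> $ i * ?v $ i"
      using \<eta>_pos by (auto simp: not_less less_imp_le)
    hence "\<forall>i\<in>UNIV. \<eta> $ i * ?v $ i = 0"
      using zero sum_nonneg_eq_0_iff[of UNIV "\<lambda>i. \<eta> $ i * ?v $ i"] by simp
    hence "?v = 0" using \<eta>_pos by (simp add: vec_eq_iff less_imp_neq[symmetric, OF \<eta>_pos])
    with nz show False ..
  qed
qed

lemma pressure_lipschitz:
  assumes "\<theta> < lo"
  shows "\<exists>L>0. \<forall>\<eta>\<in>pos_stochastic. \<forall>s\<in>{lo..hi}. \<forall>t\<in>{lo..hi}.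
     \<bar>pressure \<gamma> \<eta> s - pressure \<gamma> \<eta> t\<bar> \<le> L * \<bar>s - t\<bar>"
proof -
  obtain L where L: "0 < L" "\<And>i s t. lo \<le> s \<Longrightarrow> s \<le> t \<Longrightarrow> t \<le> hi \<Longrightarrow>
      log_sum s $ i - log_sum t $ i \<le> L * (t - s)"
    using log_sum_lipschitz[OF assms, of hi] by metis
  have *: "\<bar>pressure \<gamma> \<eta> s - pressure \<gamma> \<eta> t\<bar> \<le> L * (t - s)"
    if \<eta>: "\<eta> \<in> pos_stochastic" and st: "lo \<le> s" "s \<le> t" "t \<le> hi" for \<eta> s t
  proof -
    have "pressure \<gamma> \<eta> s - pressure \<gamma> \<eta> t = (\<Sum>i\<in>UNIV. \<eta> $ i * (log_sum s $ i - log_sum t $ i))"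
      by (simp add: pressure_eq_inner inner_vec_def sum_subtractf right_diff_distrib)
    also have "\<dots> \<le> (\<Sum>i\<in>UNIV. \<eta> $ i * (L * (t - s)))"
      using \<eta> L(2)[OF st] by (intro sum_mono mult_left_mono) (auto simp: pos_stochastic_def less_imp_le)
    also have "\<dots> = L * (t - s)"
      using \<eta> by (simp add: pos_stochastic_def flip: sum_distrib_right)
    finally have "pressure \<gamma> \<eta> s - pressure \<gamma> \<eta> t \<le> L * (t - s)" .
    moreover have "pressure \<gamma> \<eta> t \<le> pressure \<gamma> \<eta> s"
      using pressure_strict_antimono[OF \<eta>, of s t] assms st by (cases "s = t") auto
    ultimately show ?thesis by simp
  qed
  have "\<bar>pressure \<gamma> \<eta> s - pressure \<gamma> \<eta> t\<bar> \<le> L * \<bar>s - t\<bar>"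
    if "\<eta> \<in> pos_stochastic" "s \<in> {lo..hi}" "t \<in> {lo..hi}" for \<eta> s t
    using *[of \<eta> s t] *[of \<eta> t s] that by (cases "s \<le> t") (auto simp: abs_minus_commute)
  with L(1) show ?thesis by blast
qed

text \<open>In terms of \<open>v = log_sum s\<close> the level set is the part of a hyperplane inside the simplex.\<close>

lemma level_set_distance:
  assumes \<rho>: "\<rho> \<in> pos_stochastic" and s: "\<theta> < s" and sign: "pressure \<gamma> \<rho> s * log_sum s $ k < 0"
    and m: "0 < m" "m \<le> \<bar>log_sum s $ k\<bar>"
  shows "infdist \<rho> {\<eta> \<in> pos_stochastic. pressure_root \<eta> = s} \<le> 2 * \<bar>pressure \<gamma> \<rho> s\<bar> / m"
proof -
  obtain \<eta> where \<eta>: "\<eta> \<in> pos_stochastic" "\<eta> \<bullet> log_sum s = 0"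
      "dist \<rho> \<eta> \<le> 2 * \<bar>\<rho> \<bullet> log_sum s\<bar> / \<bar>log_sum s $ k\<bar>"
    using hyperplane_distance[OF \<rho>, of "log_sum s" k] sign by (auto simp: pressure_eq_inner)
  have "pressure_root \<eta> = s"
    using pressure_root_less_iff(3)[OF \<eta>(1) s] \<eta>(2) by (simp add: pressure_eq_inner)
  hence "infdist \<rho> {\<eta> \<in> pos_stochastic. pressure_root \<eta> = s} \<le> dist \<rho> \<eta>"
    using \<eta>(1) by (intro infdist_le) simp
  also have "\<dots> \<le> 2 * \<bar>pressure \<gamma> \<rho> s\<bar> / \<bar>log_sum s $ k\<bar>" using \<eta>(3) by (simp add: pressure_eq_inner)
  also have "\<dots> \<le> 2 * \<bar>pressure \<gamma> \<rho> s\<bar> / m"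
    using m by (intro divide_left_mono) auto
  finally show ?thesis .
qed

text \<open>Lojasiewicz inequality with exponent one.  The constant depends only on \<open>K\<close>, although \<open>p\<close> ranges over
  the whole open simplex: values \<open>pressure_root p\<close> far from those taken on \<open>K\<close> are harmless since distances in
  the simplex are at most \<open>2\<close>, and the others lie in a compact interval \<open>{a'..b'}\<close> above \<open>\<theta>\<close>.\<close>

lemma pressure_root_error_bound:
  assumes K: "compact K" "K \<subseteq> pos_stochastic"
  shows "\<exists>C>0. \<forall>\<rho>\<in>K. \<forall>p\<in>pos_stochastic.
    C * infdist \<rho> {\<eta>\<in>pos_stochastic. pressure_root \<eta> = pressure_root p}
      \<le> \<bar>pressure_root \<rho> - pressure_root p\<bar>"
proof -
  consider "K = {}" | s where "\<theta> < s" "log_sum s = 0"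
    | "K \<noteq> {}" "\<And>s. \<theta> < s \<Longrightarrow> log_sum s \<noteq> 0" by blast
  thus ?thesis
  proof cases
    case 1
    thus ?thesis by (auto intro: exI[of _ 1])
  next
    case 2
    \<comment> \<open>Every pressure vanishes at \<open>s\<close>, so all level sets in question are the whole open simplex.\<close>
    have root: "pressure_root \<eta> = s" if "\<eta> \<in> pos_stochastic" for \<eta>
      using pressure_root_less_iff(3)[OF that 2(1)] 2(2) by (simp add: pressure_eq_inner)
    have "infdist \<rho> {\<eta>\<in>pos_stochastic. pressure_root \<eta> = pressure_root p} = 0"
      if "\<rho> \<in> K" "p \<in> pos_stochastic" for \<rho> p
      using that K(2) root by (intro in_closed_iff_infdist_zero[THEN iffD1] infdist_zero) auto
    thus ?thesis by (intro exI[of _ 1]) auto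
  next
    case 3
    have cont: "continuous_on K pressure_root"
      using pressure_root_continuous K(2) by (rule continuous_on_subset)
    obtain \<rho>1 where \<rho>1: "\<rho>1 \<in> K" "\<And>\<rho>. \<rho> \<in> K \<Longrightarrow> pressure_root \<rho>1 \<le> pressure_root \<rho>"
      using continuous_attains_inf[OF K(1) 3(1) cont] by blast
    obtain \<rho>2 where \<rho>2: "\<rho>2 \<in> K" "\<And>\<rho>. \<rho> \<in> K \<Longrightarrow> pressure_root \<rho> \<le> pressure_root \<rho>2"
      using continuous_attains_sup[OF K(1) 3(1) cont] by blast
    define a b where "a = pressure_root \<rho>1" and "b = pressure_root \<rho>2"
    have a: "\<theta> < a" and b: "\<theta> < b" unfolding a_def b_def using pressure_root(1) \<rho>1 \<rho>2 K(2) by auto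
    obtain l where l: "log_sum a $ l < 0"
      unfolding a_def using log_sum_mixed_signs(2)[of \<rho>1] \<rho>1(1) K(2) 3(2)[OF a] a_def by auto
    obtain k where k: "0 < log_sum b $ k"
      unfolding b_def using log_sum_mixed_signs(1)[of \<rho>2] \<rho>2(1) K(2) 3(2)[OF b] b_def by auto
    \<comment> \<open>The roots of vectors in \<open>K\<close> fill part of \<open>{a..b}\<close>.  By monotonicity the coordinate \<open>l\<close>, negative at
      \<open>a\<close>, is negative from slightly left of \<open>a\<close> onwards, and \<open>k\<close> is positive up to slightly right of \<open>b\<close>.\<close>
    have "eventually (\<lambda>s. log_sum s $ l < 0) (at_left a)"
      using isCont_log_sum[OF a, of l] l unfolding isCont_def
      by (intro order_tendstoD(2)[of _ "log_sum a $ l"]) (auto intro: tendsto_within_subset)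
    moreover have "eventually (\<lambda>s. s \<in> {\<theta><..<a}) (at_left a)"
      by (rule eventually_at_leftI[of \<theta>]) (use a in auto)
    ultimately have "eventually (\<lambda>s. log_sum s $ l < 0 \<and> s \<in> {\<theta><..<a}) (at_left a)"
      by (rule eventually_conj)
    then obtain a' where a': "log_sum a' $ l < 0" "\<theta> < a'" "a' < a"
      using eventually_happens'[OF trivial_limit_at_left_real] by fastforce
    have "eventually (\<lambda>s. 0 < log_sum s $ k) (at_right b)"
      using isCont_log_sum[OF b, of k] k unfolding isCont_def
      by (intro order_tendstoD(1)[of _ "log_sum b $ k"]) (auto intro: tendsto_within_subset)
    hence "eventually (\<lambda>s. 0 < log_sum s $ k \<and> s \<in> {b<..<b+1}) (at_right b)"
      by (rule eventually_conj) (rule eventually_at_rightI[of b "b + 1"], auto)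
    then obtain b' where b': "0 < log_sum b' $ k" "b < b'"
      using eventually_happens'[OF trivial_limit_at_right_real] by fastforce
    obtain L where L: "0 < L" "\<And>\<eta> s t. \<eta> \<in> pos_stochastic \<Longrightarrow> s \<in> {a'..b'} \<Longrightarrow> t \<in> {a'..b'} \<Longrightarrow>
        \<bar>pressure \<gamma> \<eta> s - pressure \<gamma> \<eta> t\<bar> \<le> L * \<bar>s - t\<bar>"
      using pressure_lipschitz[OF a'(2), of b'] by metis
    define m where "m = min (- log_sum a' $ l) (log_sum b' $ k)"
    define \<delta> where "\<delta> = min (a - a') (b' - b)"
    have m: "0 < m" and \<delta>: "0 < \<delta>" using a' b' by (auto simp: m_def \<delta>_def)
    define C where "C = min (\<delta> / 2) (m / (2 * L))"
    have C: "0 < C" "C * 2 \<le> \<delta>" "C * (2 * L) \<le> m"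
      using m \<delta> L(1) by (auto simp: C_def min_def field_simps)
    have "C * infdist \<rho> {\<eta>\<in>pos_stochastic. pressure_root \<eta> = pressure_root p}
        \<le> \<bar>pressure_root \<rho> - pressure_root p\<bar>"
      if \<rho>: "\<rho> \<in> K" and p: "p \<in> pos_stochastic" for \<rho> p
    proof -
      define s where "s = pressure_root p"
      define s0 where "s0 = pressure_root \<rho>"
      let ?Z = "{\<eta>\<in>pos_stochastic. pressure_root \<eta> = s}"
      have \<rho>V: "\<rho> \<in> pos_stochastic" using \<rho> K(2) by blast
      have s: "\<theta> < s" using pressure_root(1)[OF p] by (simp add: s_def)
      have s0: "a \<le> s0" "s0 \<le> b" using \<rho>1(2) \<rho>2(2) \<rho> by (auto simp: a_def b_def s0_def)
      have P0: "pressure \<gamma> \<rho> s0 = 0" using pressure_root(2)[OF \<rho>V] by (simp add: s0_def)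
      have "C * infdist \<rho> ?Z \<le> \<bar>s0 - s\<bar>"
      proof (cases "\<delta> \<le> \<bar>s0 - s\<bar>")
        case True
        have "infdist \<rho> ?Z \<le> dist \<rho> p" by (rule infdist_le) (use p in \<open>simp add: s_def\<close>)
        also have "\<dots> \<le> 2"
          using norm_triangle_ineq4[of \<rho> p] pos_stochastic_norm_le[OF \<rho>V] pos_stochastic_norm_le[OF p]
          by (simp add: dist_norm)
        finally have "C * infdist \<rho> ?Z \<le> C * 2" using C(1) by simp
        thus ?thesis using C(2) True by linarith
      next
        case False
        hence range: "s \<in> {a'..b'}" "s0 \<in> {a'..b'}" using s0 a' b' by (auto simp: \<delta>_def)
        have lip: "\<bar>pressure \<gamma> \<rho> s\<bar> \<le> L * \<bar>s0 - s\<bar>"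
          using L(2)[OF \<rho>V range] P0 by (simp add: abs_minus_commute)
        have close: ?thesis if "pressure \<gamma> \<rho> s * log_sum s $ i < 0" "m \<le> \<bar>log_sum s $ i\<bar>" for i
        proof -
          have "C * infdist \<rho> ?Z \<le> C * (2 * \<bar>pressure \<gamma> \<rho> s\<bar> / m)"
            using level_set_distance[OF \<rho>V s that(1) m that(2)] C(1) by (intro mult_left_mono) auto
          also have "\<dots> \<le> C * (2 * (L * \<bar>s0 - s\<bar>) / m)"
            using lip C(1) m by (intro mult_left_mono divide_right_mono) auto
          also have "\<dots> = (C * (2 * L)) / m * \<bar>s0 - s\<bar>" by simp
          also have "\<dots> \<le> 1 * \<bar>s0 - s\<bar>" using C(3) m by (intro mult_right_mono) auto
          finally show ?thesis by simp
        qed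
        consider "s = s0" | "s0 < s" | "s < s0" by linarith
        thus ?thesis
        proof cases
          case 1
          hence "\<rho> \<in> ?Z" using \<rho>V by (simp add: s0_def)
          thus ?thesis using 1 by simp
        next
          case 2
          have "log_sum b' $ k \<le> log_sum s $ k"
            using log_sum_strict_antimono[OF s, of b' k] range by (cases "s = b'") auto
          moreover have "pressure \<gamma> \<rho> s < 0"
            using pressure_root_less_iff(1)[OF \<rho>V s] 2 by (simp add: s0_def)
          ultimately show ?thesis using b'(1) by (intro close[of k]) (auto simp: m_def mult_neg_pos)
        next
          case 3
          have "log_sum s $ l \<le> log_sum a' $ l"
            using log_sum_strict_antimono[OF a'(2), of s l] range by (cases "s = a'") auto
          moreover have "0 < pressure \<gamma> \<rho> s"
            using pressure_root_less_iff(2)[OF \<rho>V s] 3 by (simp add: s0_def)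
          ultimately show ?thesis using a'(1) by (intro close[of l]) (auto simp: m_def mult_pos_neg)
        qed
      qed
      thus ?thesis by (simp add: s_def s0_def)
    qed
    with C(1) show ?thesis by blast
  qed
qed

text \<open>Globally on the open orthant the level set is cut out by two affine functions: the coordinate sum minus
  \<open>1\<close>, and the pressure at \<open>s\<close>.\<close>

lemma level_set_subvariety:
  assumes s: "\<theta> < s"
  shows "real_analytic_subvariety {\<eta>. \<forall>i. 0 < \<eta> $ i} {\<eta> \<in> pos_stochastic. pressure_root \<eta> = s}"
    (is "real_analytic_subvariety ?U ?Z")
proof -
  have "?U = (\<Inter>i. {\<eta> :: real^'n. 0 < \<eta> $ i})" by auto
  moreover have "open {\<eta> :: real^'n. 0 < \<eta> $ i}" for i
    by (intro open_Collect_less continuous_intros)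
  ultimately have U: "open ?U" by auto
  define f1 where "f1 = (\<lambda>\<eta> :: real^'n. 1 \<bullet> \<eta> + (-1))"
  define f2 where "f2 = (\<lambda>\<eta> :: real^'n. log_sum s \<bullet> \<eta> + 0)"
  have f1: "f1 \<eta> = (\<Sum>i\<in>UNIV. \<eta> $ i) - 1" for \<eta> by (simp add: f1_def inner_vec_def)
  have f2: "f2 \<eta> = pressure \<gamma> \<eta> s" for \<eta> by (simp add: f2_def pressure_eq_inner inner_commute)
  have Z: "?Z = {z \<in> ?U. \<forall>f\<in>{f1, f2}. f z = 0}"
  proof (intro set_eqI iffI)
    fix z assume "z \<in> ?Z"
    thus "z \<in> {z \<in> ?U. \<forall>f\<in>{f1, f2}. f z = 0}"
      using pressure_root(2)[of z] by (auto simp: f1 f2 pos_stochastic_def)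
  next
    fix z assume z: "z \<in> {z \<in> ?U. \<forall>f\<in>{f1, f2}. f z = 0}"
    hence "z \<in> pos_stochastic" by (simp add: f1 pos_stochastic_def)
    thus "z \<in> ?Z" using z pressure_root_less_iff(3)[of z s] s by (simp add: f2)
  qed
  have an: "\<forall>f\<in>{f1, f2}. real_analytic_on f ?U"
    by (simp only: f1_def f2_def ball_simps real_analytic_on_affine simp_thms)
  have sub: "?Z \<subseteq> ?U" using Z by blast
  have nbhd: "\<exists>N fs. open N \<and> a \<in> N \<and> N \<subseteq> ?U \<and> finite fs \<and>
        (\<forall>f\<in>fs. real_analytic_on f N) \<and> ?Z \<inter> N = {z \<in> N. \<forall>f\<in>fs. f z = 0}" if "a \<in> ?U" for a
    by (rule exI[of _ ?U], rule exI[of _ "{f1, f2}"]) (use U that an Z in blast)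
  show ?thesis unfolding real_analytic_subvariety_def by (intro conjI ballI U sub nbhd)
qed

lemma moran_fractal_dim:
  fixes J :: "'a::euclidean_space set"
  assumes J: "compact J" "interior J \<noteq> {}" "diameter J = 1"
    and \<eta>: "\<eta> \<in> pos_stochastic" "has_frequencies \<omega> \<eta>" and S: "moran_collection J \<gamma> \<omega> S"
  shows "hausdorff_dim (moran_fractal S) = pressure_root \<eta>"
proof -
  interpret moran_construction \<gamma> J \<omega> S by unfold_locales (use J S in auto)
  show ?thesis using hausdorff_dim_eq_pressure_zero[OF \<eta> pressure_root[OF \<eta>(1)]] .
qed

text \<open>The description in \<open>moran_dim\<close> is vacuously true of every number unless some collection with these
  frequencies exists, so uniqueness uses the existence of a digit sequence with frequencies \<open>\<eta>\<close>.\<close>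

lemma moran_dim_eq_pressure_root:
  fixes J :: "'a::euclidean_space set"
  assumes J: "compact J" "interior J \<noteq> {}" "diameter J = 1"
    and ex: "\<And>\<omega>. has_frequencies \<omega> \<eta> \<Longrightarrow> \<exists>T. moran_collection J \<gamma> \<omega> T"
    and \<eta>: "\<eta> \<in> pos_stochastic"
  shows "moran_dim J \<gamma> \<eta> = pressure_root \<eta>"
  unfolding moran_dim_def
proof (rule the_equality)
  show "\<forall>\<omega> S. has_frequencies \<omega> \<eta> \<longrightarrow> moran_collection J \<gamma> \<omega> S \<longrightarrow>
      hausdorff_dim (moran_fractal S) = pressure_root \<eta>"
    using moran_fractal_dim[OF J \<eta>] by blast
next
  fix s assume s: "\<forall>\<omega> S. has_frequencies \<omega> \<eta> \<longrightarrow> moran_collection J \<gamma> \<omega> S \<longrightarrow>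
      hausdorff_dim (moran_fractal S) = s"
  obtain \<omega> where \<omega>: "has_frequencies \<omega> \<eta>" using has_frequencies_exists[OF \<eta>] by blast
  then obtain T where T: "moran_collection J \<gamma> \<omega> T" using ex by blast
  show "s = pressure_root \<eta>" using s \<omega> T moran_fractal_dim[OF J \<eta> \<omega> T] by metis
qed

end

section \<open>Dimensions along digit expansions\<close>

theorem corollary4p4:
  fixes b :: real
    and letter :: "int \<Rightarrow> 'n::finite"
    and \<gamma> :: "'n \<Rightarrow> nat \<Rightarrow> real"
    and J :: "'a::euclidean_space set"
    and S :: "real \<Rightarrow> nat list \<Rightarrow> 'a set"
  assumes base:
      "(\<exists>m::int. 2 \<le> m \<and> b = real_of_int m \<and> bij_betw letter {0..m - 1} UNIV) \<or>
       (1 < b \<and> b \<notin> \<int> \<and> bij_betw letter {0..\<lfloor>b\<rfloor>} UNIV)"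
    and gamma_pos: "\<And>i j. 0 < \<gamma> i j"
    and gamma_summable: "\<And>i. summable (\<gamma> i)"
    and gamma_sup: "\<exists>c<1. \<forall>i j. \<gamma> i j \<le> c"
    and J: "J \<noteq> {}" "compact J" "J = closure (interior J)" "diameter J = 1"
    and divergence: "\<exists>i. \<not> summable (\<lambda>j. \<gamma> i j powr crit_exponent \<gamma>)"
    and pressure_pos:
      "\<And>\<eta>. \<eta> \<in> pos_stochastic \<Longrightarrow>
         \<exists>u>crit_exponent \<gamma>. (\<forall>i. summable (\<lambda>j. \<gamma> i j powr u)) \<and> 0 < pressure \<gamma> \<eta> u"
    and collections_exist:
      "\<And>\<eta> \<omega>. \<eta> \<in> pos_stochastic \<Longrightarrow> has_frequencies \<omega> \<eta> \<Longrightarrow> \<exists>T. moran_collection J \<gamma> \<omega> T"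
    and collection:
      "\<And>x. x \<in> all_freq_set letter b \<Longrightarrow> moran_collection J \<gamma> (digit_word letter b x) (S x)"
  shows
    "(\<forall>K. compact K \<and> K \<subseteq> pos_stochastic \<longrightarrow>
        (\<exists>C>0. \<exists>q::nat. 1 \<le> q \<and>
          (\<forall>x\<in>all_freq_set letter b. \<forall>\<rho>\<in>K. \<forall>y\<in>freq_set letter b \<rho>.
             \<bar>dim_fun S y - dim_fun S x\<bar>
               \<ge> C * infdist \<rho> (dim_level_set J \<gamma> (dim_fun S x)) ^ q)))
     \<and> (\<forall>x\<in>all_freq_set letter b.
          real_analytic_subvariety {\<eta> :: real^'n. \<forall>i. 0 < \<eta> $ i}
            (dim_level_set J \<gamma> (dim_fun S x)))
     \<and> (\<forall>x\<in>all_freq_set letter b. \<forall>\<rho>\<in>pos_stochastic. \<forall>y\<in>freq_set letter b \<rho>.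
          dim_fun S y = dim_fun S x \<longrightarrow> \<rho> \<in> dim_level_set J \<gamma> (dim_fun S x))"
proof -
  interpret positive_pressure_vectors \<gamma>
    by unfold_locales (use gamma_pos gamma_summable gamma_sup pressure_pos in blast)+
  have int: "interior J \<noteq> {}" using J(1,3) by auto
  have dim_fun: "dim_fun S y = pressure_root \<rho>"
    if "\<rho> \<in> pos_stochastic" "y \<in> freq_set letter b \<rho>" for y \<rho>
  proof -
    have "y \<in> all_freq_set letter b" using that by (auto simp: all_freq_set_def)
    moreover have "has_frequencies (digit_word letter b y) \<rho>" using that(2) by (simp add: freq_set_def)
    ultimately show ?thesis
      unfolding dim_fun_def using moran_fractal_dim[OF J(2) int J(4) that(1) _ collection] by blast
  qed
  have level: "dim_level_set J \<gamma> s = {\<eta> \<in> pos_stochastic. pressure_root \<eta> = s}" for s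
    unfolding dim_level_set_def
    using moran_dim_eq_pressure_root[OF J(2) int J(4) collections_exist] by auto
  have base_point: "\<exists>p\<in>pos_stochastic. dim_fun S x = pressure_root p" if "x \<in> all_freq_set letter b" for x
    using that dim_fun by (auto simp: all_freq_set_def)
  show ?thesis
  proof (intro conjI allI ballI impI)
    fix K :: "(real^'n) set" assume K: "compact K \<and> K \<subseteq> pos_stochastic"
    then obtain C where C: "0 < C" "\<forall>\<rho>\<in>K. \<forall>p\<in>pos_stochastic.
        C * infdist \<rho> {\<eta>\<in>pos_stochastic. pressure_root \<eta> = pressure_root p}
          \<le> \<bar>pressure_root \<rho> - pressure_root p\<bar>"
      using pressure_root_error_bound[of K] by blast
    have "C * infdist \<rho> (dim_level_set J \<gamma> (dim_fun S x)) ^ 1 \<le> \<bar>dim_fun S y - dim_fun S x\<bar>"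
      if x: "x \<in> all_freq_set letter b" and \<rho>: "\<rho> \<in> K" and y: "y \<in> freq_set letter b \<rho>"
      for x \<rho> y
    proof -
      obtain p where p: "p \<in> pos_stochastic" "dim_fun S x = pressure_root p"
        using base_point[OF x] by blast
      have "\<rho> \<in> pos_stochastic" using \<rho> K by blast
      thus ?thesis using C(2)[rule_format, OF \<rho> p(1)] dim_fun[OF _ y] p(2) by (simp add: level)
    qed
    thus "\<exists>C>0. \<exists>q::nat. 1 \<le> q \<and>
          (\<forall>x\<in>all_freq_set letter b. \<forall>\<rho>\<in>K. \<forall>y\<in>freq_set letter b \<rho>.
             \<bar>dim_fun S y - dim_fun S x\<bar>
               \<ge> C * infdist \<rho> (dim_level_set J \<gamma> (dim_fun S x)) ^ q)"
      by (intro exI[of _ C] exI[of _ 1] conjI ballI C(1) order_refl)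
  next
    fix x assume "x \<in> all_freq_set letter b"
    then obtain p where p: "p \<in> pos_stochastic" "dim_fun S x = pressure_root p" using base_point by blast
    show "real_analytic_subvariety {\<eta> :: real^'n. \<forall>i. 0 < \<eta> $ i} (dim_level_set J \<gamma> (dim_fun S x))"
      unfolding level p(2) by (rule level_set_subvariety[OF pressure_root(1)[OF p(1)]])
  next
    fix x \<rho> y
    assume "\<rho> \<in> pos_stochastic" "y \<in> freq_set letter b \<rho>" "dim_fun S y = dim_fun S x"
    thus "\<rho> \<in> dim_level_set J \<gamma> (dim_fun S x)" using dim_fun[of \<rho> y] by (simp add: level)
  qed
qed

end
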